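(* Let $\mathbb{G}$ be $\mathbb{R}$, $\mathbb{C}$ or the quaternions $\mathbb{Q}$, let $\hat{\mathbb{G}}$ be the corresponding ring of dual elements, let $A = A_s + A_d\epsilon \in \hat{\mathbb{G}}^{n\times n}$ be a dual Hermitian matrix, and let the real number $\lambda_s$ be a $k$-multiple eigenvalue of the Hermitian matrix $A_s\in\mathbb{G}^{n\times n}$. (1) If $k=1$, i.e. $\lambda_s$ is a single eigenvalue of $A_s$, let $\mathbf{x}_s$ be a unit eigenvector of $A_s$ associated with $\lambda_s$. Then $\lambda=\lambda_s+\lambda_d\epsilon$ is a single eigenvalue of $A$, where $\lambda_d=\mathbf{x}_s^*A_d\mathbf{x}_s$, with an eigenvector $\mathbf{x}=\mathbf{x}_s+\mathbf{x}_d\epsilon$, where $\mathbf{x}_d\in\mathbb{G}^n$ is a solution of $$(\lambda_s I-A_s)\mathbf{x}_d=(A_d-\lambda_d I)\mathbf{x}_s .$$ (2) If $k>1$, let $\mathbf{v}_1,\dots,\mathbf{v}_k$ be $k$ orthonormal eigenvectors of $A_s$ associated with $\lambda_s$, and let $W=(\mathbf{v}_1,\dots,\mathbf{v}_k)$. Then $W$ is an $n\times k$ partially unitary matrix, and $W^*A_dW\in\mathbb{G}^{k\times k}$ is a Hermitian matrix. Let $\lambda_{d1},\dots,\lambda_{dk}$ be the $k$ eigenvalues of $W^*A_dW$, with corresponding eigenvectors $\mathbf{y}_1,\dots,\mathbf{y}_k$. Then $\lambda_i=\lambda_s+\lambda_{di}\epsilon$, $i=1,\dots,k$, are eigenvalues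 of $A$, with eigenvectors $\mathbf{x}_i=\mathbf{x}_{si}+\mathbf{x}_{di}\epsilon$, $i=1,\dots,k$, where $\mathbf{x}_{si}=W\mathbf{y}_i$ and $\mathbf{x}_{di}\in\mathbb{G}^n$ is a solution of $$(\lambda_s I-A_s)\mathbf{x}_{di}=(A_d-\lambda_{di}I)\mathbf{x}_{si},\qquad i=1,\dots,k.$$
   Context: $\mathbb{Q}$ denotes the ring of (real) quaternions. For $\mathbb{G}\in\{\mathbb{R},\mathbb{C},\mathbb{Q}\}$, $\hat{\mathbb{G}}=\{a_s+a_d\epsilon : a_s,a_d\in\mathbb{G}\}$, where $\epsilon^2=0$, $\epsilon\neq0$, and $\epsilon$ commutes with all elements of $\mathbb{G}$; $a_s$ is the standard part and $a_d$ the dual part. Elements of $\hat{\mathbb{R}}$ are called dual numbers. Matrices and vectors over $\hat{\mathbb{G}}$ are written $A=A_s+A_d\epsilon$, $\mathbf{x}=\mathbf{x}_s+\mathbf{x}_d\epsilon$ with parts over $\mathbb{G}$. Conjugation is $(a_s+a_d\epsilon)^*=a_s^*+a_d^*\epsilon$ (trivial on $\mathbb{R}$), and $A^*$, $\mathbf{x}^*$ are conjugate transposes. A square matrix over $\mathbb{G}$ (resp. $\hat{\mathbb{G}}$) is Hermitian (resp. dual Hermitian) if $A^*=A$; so for $A=A_s+A_d\epsilon$ dual Hermitian, both $A_s$ and $A_d$ are Hermitian. A vector $\mathbf{x}\in\hat{\mathbb{G}}^n$ is appreciable if $\mathbf{x}_s\ne\mathbf{0}$. An element $\lambda\in\hat{\mathbb{G}}$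 is an eigenvalue of a dual Hermitian matrix $A$, with eigenvector $\mathbf{x}$, if $\mathbf{x}\in\hat{\mathbb{G}}^n$ is appreciable and $A\mathbf{x}=\mathbf{x}\lambda$; all such $\lambda$ are dual numbers (so also $A\mathbf{x}=\lambda\mathbf{x}$). An $n\times n$ dual Hermitian matrix has exactly $n$ dual number eigenvalues counted with multiplicity (there is $U\in\hat{\mathbb{G}}^{n\times n}$ with $U^*U=UU^*=I$ and $U^*AU=\mathrm{diag}(\lambda_1,\dots,\lambda_n)$, the dual numbers $\lambda_i$ being unique up to order). Eigenvalues of a Hermitian matrix over $\mathbb{G}$ are its (right) eigenvalues; these are real, and there are as many as the size of the matrix, counted with multiplicity. An eigenvalue is $k$-multiple if its multiplicity is $k$, and single if its multiplicity is $1$. Eigenvectors over $\mathbb{G}$ are nonzero. Unit and orthonormal refer to $\mathbf{u}^*\mathbf{v}$. An $n\times k$ matrix $W$ is partially unitary if its columns are unit vectors orthogonal to each other, i.e. $W^*W=I_k$. The matrix $W^*A_dW$ is called the supplement matrix of $A$ corresponding to $\lambda_s$. *)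

theory Defs
  imports Complex_Main "Jordan_Normal_Form.Matrix"
begin

text \<open>
  Scalars come from a type of class \<open>real_complex_quat\<close> (real, complex or quaternion), dual
  scalars from \<open>'g dual\<close>. The class \<open>conjugate\<close> of the matrix library provides \<open>a\<^sup>*\<close> without
  imposing multiplicativity, which fails for quaternions; vectors and matrices are those of the
  matrix library, which allow non-commutative entries.
\<close>

subsection \<open>Quaternions\<close>

datatype quat = Quat (qre: real) (qi: real) (qj: real) (qk: real)

instantiation quat :: real_algebra_1
begin

definition "0 = Quat 0 0 0 0"
definition "1 = Quat 1 0 0 0"
definition "p + q = Quat (qre p + qre q) (qi p + qi q) (qj p + qj q) (qk p + qk q)"
definition "- p = Quat (- qre p) (- qi p) (- qj p) (- qk p)"
definition "p - q = Quat (qre p - qre q) (qi p - qi q) (qj p - qj q) (qk p - qk q)"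
definition "p * q = Quat
  (qre p * qre q - qi p * qi q - qj p * qj q - qk p * qk q)
  (qre p * qi q + qi p * qre q + qj p * qk q - qk p * qj q)
  (qre p * qj q - qi p * qk q + qj p * qre q + qk p * qi q)
  (qre p * qk q + qi p * qj q - qj p * qi q + qk p * qre q)"
definition "r *\<^sub>R p = Quat (r * qre p) (r * qi p) (r * qj p) (r * qk p)"

instance
  by standard
    (auto simp: zero_quat_def one_quat_def plus_quat_def uminus_quat_def minus_quat_def
      times_quat_def scaleR_quat_def algebra_simps)

end

instantiation quat :: conjugate
begin

definition "conjugate p = Quat (qre p) (- qi p) (- qj p) (- qk p)"

instance
  by standard (auto simp: conjugate_quat_def intro: quat.expand)

end

lemma quat_units:
  "Quat 0 1 0 0 * Quat 0 1 0 0 = - 1"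
  "Quat 0 0 1 0 * Quat 0 0 1 0 = - 1"
  "Quat 0 0 0 1 * Quat 0 0 0 1 = - 1"
  "Quat 0 1 0 0 * Quat 0 0 1 0 * Quat 0 0 0 1 = - 1"
  by (simp_all add: times_quat_def uminus_quat_def one_quat_def)

subsection \<open>The three scalar algebras\<close>

text \<open>The operations of the domain are arguments because a class axiom can only refer to
  class operations on its own type through the parameters of the class.\<close>

definition star_algebra_iso ::
    "('a \<Rightarrow> 'a \<Rightarrow> 'a) \<Rightarrow> ('a \<Rightarrow> 'a \<Rightarrow> 'a) \<Rightarrow> (real \<Rightarrow> 'a \<Rightarrow> 'a) \<Rightarrow> ('a \<Rightarrow> 'a) \<Rightarrow>
     ('a \<Rightarrow> 'b::{real_algebra_1,conjugate}) \<Rightarrow> bool" where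
  "star_algebra_iso plus_a times_a scale_a conj_a f \<longleftrightarrow> bij f \<and>
     (\<forall>x y. f (plus_a x y) = f x + f y) \<and>
     (\<forall>x y. f (times_a x y) = f x * f y) \<and>
     (\<forall>r x. f (scale_a r x) = r *\<^sub>R f x) \<and>
     (\<forall>x. f (conj_a x) = conjugate (f x))"

text \<open>
  Up to isomorphism of real algebras with conjugation, the types of this class are exactly
  the reals, the complex numbers and the quaternions. It serves to quantify over these three.
\<close>

class real_complex_quat = real_algebra_1 + conjugate +
  assumes real_complex_or_quat:
    "(\<exists>f :: 'a \<Rightarrow> real. star_algebra_iso (+) (*) (*\<^sub>R) conjugate f) \<or>
     (\<exists>f :: 'a \<Rightarrow> complex. star_algebra_iso (+) (*) (*\<^sub>R) conjugate f) \<or>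
     (\<exists>f :: 'a \<Rightarrow> quat. star_algebra_iso (+) (*) (*\<^sub>R) conjugate f)"

lemma star_algebra_iso_id:
  "star_algebra_iso (+) (*) (*\<^sub>R) conjugate
     (\<lambda>x. x :: 'a::{real_algebra_1,conjugate})"
  by (simp add: star_algebra_iso_def bij_def)

instance real :: real_complex_quat
  by standard (blast intro: star_algebra_iso_id)

instance complex :: real_complex_quat
  by standard (blast intro: star_algebra_iso_id)

instance quat :: real_complex_quat
  by standard (blast intro: star_algebra_iso_id)

subsection \<open>Dual scalars\<close>

text \<open>\<open>Dual a b\<close> is \<open>a + b\<epsilon>\<close>. Dual numbers are the elements of \<open>real dual\<close>; the map
  \<open>map_dual of_real\<close> embeds them into \<open>'g dual\<close>.\<close>

datatype 'a dual = Dual (std_part: 'a) (dual_part: 'a)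

instantiation dual :: (ring_1) ring_1
begin

definition "0 = Dual 0 0"
definition "1 = Dual 1 0"
definition "x + y = Dual (std_part x + std_part y) (dual_part x + dual_part y)"
definition "- x = Dual (- std_part x) (- dual_part x)"
definition "x - y = Dual (std_part x - std_part y) (dual_part x - dual_part y)"
definition "x * y = Dual (std_part x * std_part y)
  (std_part x * dual_part y + dual_part x * std_part y)"

instance
  by standard
    (simp_all add: zero_dual_def one_dual_def plus_dual_def uminus_dual_def minus_dual_def
      times_dual_def algebra_simps)

end

instantiation dual :: (conjugate) conjugate
begin

definition "conjugate x = Dual (conjugate (std_part x)) (conjugate (dual_part x))"

instance
  by standard (auto simp: conjugate_dual_def intro: dual.expand)

end

definition eps :: "'a::ring_1 dual" where
  "eps = Dual 0 1"

lemma dual_eps: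
  "eps * eps = (0 :: 'a::ring_1 dual)"
  "eps \<noteq> (0 :: 'a dual)"
  "eps * Dual a 0 = Dual a 0 * eps"
  "Dual a b = Dual a 0 + Dual b 0 * eps"
  by (simp_all add: eps_def zero_dual_def times_dual_def plus_dual_def)

definition dual_vec :: "'a vec \<Rightarrow> 'a vec \<Rightarrow> 'a dual vec" where
  "dual_vec xs xd = vec (dim_vec xs) (\<lambda>i. Dual (xs $ i) (xd $ i))"

definition appreciable :: "'a::zero dual vec \<Rightarrow> bool" where
  "appreciable x \<longleftrightarrow> map_vec std_part x \<noteq> 0\<^sub>v (dim_vec x)"

subsection \<open>Matrices over a ring with conjugation\<close>

definition adj :: "'a::conjugate mat \<Rightarrow> 'a mat" where
  "adj A = transpose_mat (map_mat conjugate A)"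

definition hermitian :: "'a::conjugate mat \<Rightarrow> bool" where
  "hermitian A \<longleftrightarrow> adj A = A"

text \<open>The product \<open>u\<^sup>* v\<close>; the order of the factors matters over the quaternions.\<close>

definition cinner :: "'a::{semiring_0,conjugate} vec \<Rightarrow> 'a vec \<Rightarrow> 'a" where
  "cinner u v = conjugate u \<bullet> v"

definition orthonormal :: "'a::{ring_1,conjugate} vec list \<Rightarrow> bool" where
  "orthonormal vs \<longleftrightarrow> (\<forall>i<length vs. \<forall>j<length vs.
     cinner (vs ! i) (vs ! j) = (if i = j then 1 else 0))"

definition partially_unitary :: "'a::{ring_1,conjugate} mat \<Rightarrow> bool" where
  "partially_unitary W \<longleftrightarrow> adj W * W = 1\<^sub>m (dim_col W)"

definition smult_vec_right :: "'a::times vec \<Rightarrow> 'a \<Rightarrow> 'a vec" where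
  "smult_vec_right x a = map_vec (\<lambda>b. b * a) x"

definition diagonal_of :: "'a::zero list \<Rightarrow> 'a mat" where
  "diagonal_of ds = mat (length ds) (length ds) (\<lambda>(i, j). if i = j then ds ! i else 0)"

definition unitarily_diagonalizes_to :: "'a::{ring_1,conjugate} mat \<Rightarrow> 'a list \<Rightarrow> bool" where
  "unitarily_diagonalizes_to A ds \<longleftrightarrow>
     A \<in> carrier_mat (length ds) (length ds) \<and>
     (\<exists>U \<in> carrier_mat (length ds) (length ds).
        adj U * U = 1\<^sub>m (length ds) \<and> U * adj U = 1\<^sub>m (length ds) \<and>
        adj U * A * U = diagonal_of ds)"

subsection \<open>Eigenvalues of Hermitian and dual Hermitian matrices\<close>

text \<open>
  Multiplicities refer to the list of diagonal entries in a unitary diagonalization; for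
  Hermitian and dual Hermitian matrices this list exists and is unique up to order, so that
  the existential quantifiers in the definitions of multiplicity are harmless.
\<close>

definition right_eigenvector ::
    "'g::real_complex_quat mat \<Rightarrow> 'g vec \<Rightarrow> 'g \<Rightarrow> bool" where
  "right_eigenvector A x l \<longleftrightarrow>
     x \<in> carrier_vec (dim_row A) \<and> x \<noteq> 0\<^sub>v (dim_row A) \<and> A *\<^sub>v x = smult_vec_right x l"

definition eigenvalue_list :: "'g::real_complex_quat mat \<Rightarrow> real list \<Rightarrow> bool" where
  "eigenvalue_list A ls \<longleftrightarrow> unitarily_diagonalizes_to A (map of_real ls)"

definition multiple_eigenvalue :: "nat \<Rightarrow> 'g::real_complex_quat mat \<Rightarrow> real \<Rightarrow> bool" where
  "multiple_eigenvalue k A l \<longleftrightarrow>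
     (\<exists>x. right_eigenvector A x (of_real l)) \<and>
     (\<exists>ls. eigenvalue_list A ls \<and> count_list ls l = k)"

definition dual_eigenvector ::
    "'g::real_complex_quat dual mat \<Rightarrow> 'g dual vec \<Rightarrow> 'g dual \<Rightarrow> bool" where
  "dual_eigenvector A x l \<longleftrightarrow>
     x \<in> carrier_vec (dim_row A) \<and> appreciable x \<and> A *\<^sub>v x = smult_vec_right x l"

definition dual_eigenvalue :: "'g::real_complex_quat dual mat \<Rightarrow> 'g dual \<Rightarrow> bool" where
  "dual_eigenvalue A l \<longleftrightarrow> (\<exists>x. dual_eigenvector A x l)"

definition dual_eigenvalue_list ::
    "'g::real_complex_quat dual mat \<Rightarrow> real dual list \<Rightarrow> bool" where
  "dual_eigenvalue_list A ls \<longleftrightarrow> unitarily_diagonalizes_to A (map (map_dual of_real) ls)"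

definition dual_multiple_eigenvalue ::
    "nat \<Rightarrow> 'g::real_complex_quat dual mat \<Rightarrow> real dual \<Rightarrow> bool" where
  "dual_multiple_eigenvalue k A l \<longleftrightarrow>
     dual_eigenvalue A (map_dual of_real l) \<and>
     (\<exists>ls. dual_eigenvalue_list A ls \<and> count_list ls l = k)"

end

theory Submission
  imports Defs "Jordan_Normal_Form.Spectral_Radius"
begin

text \<open>
  Every dual Hermitian matrix is brought to diagonal form in two steps. A unitary matrix over the
  scalars, built from Householder reflections, diagonalizes \<open>A\<^sub>s\<close> and at the same time the diagonal
  blocks of \<open>A\<^sub>d\<close> on the eigenspaces of \<open>A\<^sub>s\<close>; an infinitesimal rotation \<open>1 + P \<epsilon>\<close> then removes the
  off-diagonal blocks of the dual part. Eigenvectors over the quaternions come from the real symmetric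
  matrix that describes the action on real coordinates. The equation
  \<open>(\<lambda>\<^sub>s I - A\<^sub>s) x\<^sub>d = (A\<^sub>d - \<lambda>\<^sub>d I) x\<^sub>s\<close> is solvable because its right-hand side is orthogonal to the
  \<open>\<lambda>\<^sub>s\<close>-eigenspace, and it is exactly the dual part of \<open>A x = x \<lambda>\<close>.
\<close>

section \<open>Scalars\<close>

text \<open>Over the quaternions neither determinants nor a characteristic polynomial are at hand,
  so multiplicities and spans are read off from explicit unitary diagonalizations. In general only
  real factors may be moved past other scalars, and eigenvectors are rescaled from the right.
  Multiplicity is a count in some diagonal list. The word "single" in (1) therefore asks for a
  complete dual diagonalization in which lambda_s + lambda_d eps occurs once; for (2) it is enough
  to produce dual eigenvectors. Diagonalizing blocks of the dual part must not undo the
  diagonalization of the standard part. The second unitary factor is therefore kept block diagonal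
  along the level sets of the eigenvalue list, hence commutes with the diagonal standard part. The
  entries left over join different eigenvalues, whose real differences can be divided by; these are
  the entries that an infinitesimal rotation can remove.\<close>

definition embed :: "'g::real_complex_quat \<Rightarrow> quat" where
  "embed = (SOME f. inj f \<and> (\<forall>x y. f (x + y) = f x + f y) \<and> (\<forall>x y. f (x * y) = f x * f y) \<and>
     (\<forall>r x. f (r *\<^sub>R x) = r *\<^sub>R f x) \<and> (\<forall>x. f (conjugate x) = conjugate (f x)) \<and> f 1 = 1)"

lemmas quat_ops = zero_quat_def one_quat_def plus_quat_def uminus_quat_def minus_quat_def
  times_quat_def scaleR_quat_def conjugate_quat_def

text \<open>Preservation of 1 comes from surjectivity: if f u = 1, then f 1 = f 1 * f u = f (1 * u)
  = 1.\<close>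

lemma star_algebra_iso_one:
  fixes f :: "'a::{real_algebra_1,conjugate} \<Rightarrow> 'b::{real_algebra_1,conjugate}"
  assumes "star_algebra_iso (+) (*) (*\<^sub>R) conjugate f"
  shows "f 1 = 1"
proof -
  obtain u where "f u = 1"
    using assms unfolding star_algebra_iso_def by (metis bij_pointE)
  then show ?thesis
    using assms unfolding star_algebra_iso_def by (metis mult.left_neutral mult.right_neutral)
qed

text \<open>The reals and the complex numbers sit inside the quaternions compatibly with
  conjugation, so one injection replaces the distinction of three cases. Identities between scalars
  then become coordinate computations in \<open>quat\<close>.\<close>

lemma embed_exists:
  "\<exists>f :: 'g::real_complex_quat \<Rightarrow> quat. inj f \<and> (\<forall>x y. f (x + y) = f x + f y) \<and>
     (\<forall>x y. f (x * y) = f x * f y) \<and> (\<forall>r x. f (r *\<^sub>R x) = r *\<^sub>R f x) \<and>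
     (\<forall>x. f (conjugate x) = conjugate (f x)) \<and> f 1 = 1"
proof -
  consider (r) f :: "'g \<Rightarrow> real" where "star_algebra_iso (+) (*) (*\<^sub>R) conjugate f"
    | (c) f :: "'g \<Rightarrow> complex" where "star_algebra_iso (+) (*) (*\<^sub>R) conjugate f"
    | (q) f :: "'g \<Rightarrow> quat" where "star_algebra_iso (+) (*) (*\<^sub>R) conjugate f"
    using real_complex_or_quat by blast
  then show ?thesis
  proof cases
    case r
    then show ?thesis using star_algebra_iso_one[OF r]
      by (intro exI[of _ "\<lambda>x. Quat (f x) 0 0 0"])
        (auto simp: star_algebra_iso_def quat_ops inj_def bij_def)
  next
    case c
    then show ?thesis using star_algebra_iso_one[OF c]
      by (intro exI[of _ "\<lambda>x. Quat (Re (f x)) (Im (f x)) 0 0"])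
        (auto simp: star_algebra_iso_def quat_ops inj_def bij_def conjugate_complex_def complex_eq_iff)
  next
    case q
    then show ?thesis using star_algebra_iso_one[OF q]
      by (intro exI[of _ f]) (auto simp: star_algebra_iso_def bij_def)
  qed
qed

lemma embed:
  fixes x y :: "'g::real_complex_quat"
  shows inj_embed: "inj (embed :: 'g \<Rightarrow> quat)"
    and embed_add: "embed (x + y) = embed x + embed y"
    and embed_mult: "embed (x * y) = embed x * embed y"
    and embed_scaleR: "embed (r *\<^sub>R x) = r *\<^sub>R embed x"
    and embed_conjugate: "embed (conjugate x) = conjugate (embed x)"
    and embed_1: "embed (1::'g) = 1"
  using someI_ex[OF embed_exists[where 'g = 'g]] unfolding embed_def[symmetric] by auto

lemma embed_eqI: "embed x = embed y \<Longrightarrow> x = y"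
  using inj_embed by (auto simp: inj_def)

lemma embed_of_real: "embed (of_real r) = Quat r 0 0 0"
  by (simp add: of_real_def embed_scaleR embed_1 quat_ops)

lemma embed_0: "embed 0 = Quat 0 0 0 0"
  using embed_of_real[of 0] by simp

section \<open>Real part, squared norm and the rules of conjugation\<close>

definition rpart :: "'g::real_complex_quat \<Rightarrow> real" where
  "rpart x = qre (embed x)"

definition sqnorm :: "'g::real_complex_quat \<Rightarrow> real" where
  "sqnorm x = (qre (embed x))\<^sup>2 + (qi (embed x))\<^sup>2 + (qj (embed x))\<^sup>2 + (qk (embed x))\<^sup>2"

lemma conj_add: "conjugate (x + y :: 'g::real_complex_quat) = conjugate x + conjugate y"
  by (rule embed_eqI) (simp add: embed quat_ops)

lemma conj_mult: "conjugate (x * y :: 'g::real_complex_quat) = conjugate y * conjugate x"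
  by (rule embed_eqI) (simp add: embed quat_ops algebra_simps)

lemma conj_scaleR: "conjugate (r *\<^sub>R x :: 'g::real_complex_quat) = r *\<^sub>R conjugate x"
  by (rule embed_eqI) (simp add: embed quat_ops)

lemma conj_of_real [simp]: "conjugate (of_real r :: 'g::real_complex_quat) = of_real r"
  by (rule embed_eqI) (simp add: embed embed_of_real quat_ops)

lemma conj_0 [simp]: "conjugate (0 :: 'g::real_complex_quat) = 0"
  using conj_of_real[of 0] by simp

lemma conj_1 [simp]: "conjugate (1 :: 'g::real_complex_quat) = 1"
  using conj_of_real[of 1] by simp

lemma conj_minus: "conjugate (- x :: 'g::real_complex_quat) = - conjugate x"
  using conj_scaleR[of "-1" x] by simp

lemma conj_diff: "conjugate (x - y :: 'g::real_complex_quat) = conjugate x - conjugate y"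
  using conj_add[of x "- y"] by (simp add: conj_minus)

lemma conj_eq_0_iff: "conjugate (x :: 'g::real_complex_quat) = 0 \<longleftrightarrow> x = 0"
  by (metis conj_0 conjugate_id)

lemma conj_sum: "conjugate (sum f I :: 'g::real_complex_quat) = (\<Sum>i\<in>I. conjugate (f i))"
  by (induct I rule: infinite_finite_induct) (auto simp: conj_add)

lemma conj_mult_self: "conjugate x * x = of_real (sqnorm (x :: 'g::real_complex_quat))"
  by (rule embed_eqI) (simp add: embed embed_of_real quat_ops sqnorm_def power2_eq_square)

lemma mult_conj_self: "x * conjugate x = of_real (sqnorm (x :: 'g::real_complex_quat))"
  by (rule embed_eqI) (simp add: embed embed_of_real quat_ops sqnorm_def power2_eq_square)

lemma sqnorm_ge_0: "sqnorm x \<ge> 0"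
  by (simp add: sqnorm_def)

lemma sqnorm_eq_0_iff: "sqnorm x = 0 \<longleftrightarrow> x = 0"
proof
  assume "sqnorm x = 0"
  then show "x = 0"
    by - (rule embed_eqI, intro quat.expand, auto simp: embed_0 sqnorm_def add_nonneg_eq_0_iff)
qed (simp add: sqnorm_def embed_0)

lemma sqnorm_0 [simp]: "sqnorm 0 = 0"
  by (simp add: sqnorm_eq_0_iff)

lemma rpart_conj: "rpart (conjugate x) = rpart x"
  by (simp add: rpart_def embed quat_ops)

lemma rpart_add: "rpart (x + y) = rpart x + rpart y"
  by (simp add: rpart_def embed quat_ops)

lemma rpart_scaleR: "rpart (r *\<^sub>R x) = r * rpart x"
  by (simp add: rpart_def embed quat_ops)

lemma rpart_0: "rpart 0 = 0"
  by (simp add: rpart_def embed_0)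

lemma rpart_sum: "rpart (sum f I) = (\<Sum>i\<in>I. rpart (f i))"
  by (induct I rule: infinite_finite_induct) (auto simp: rpart_add rpart_0)

lemma of_real_commute: "of_real r * x = x * (of_real r :: 'g::real_algebra_1)"
  by (simp add: of_real_def)

text \<open>The real part is half of x + conjugate x. This describes it without reference to the
  arbitrarily chosen \<open>embed\<close>.\<close>

lemma rpart_eqI:
  assumes "x + conjugate x = of_real (2 * r)"
  shows "rpart x = r"
proof -
  have "rpart x + rpart x = rpart (of_real (2 * r) :: 'a)"
    using arg_cong[OF assms, of rpart] by (simp only: rpart_add rpart_conj)
  also have "\<dots> = 2 * r"
    by (simp only: rpart_def embed_of_real quat.sel)
  finally show ?thesis by simp
qed

text \<open>An orthonormal basis of the scalars as a real vector space, for the inner product given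
  by the real part of conjugate x * y. The real part is a parameter so that the concrete functions
  \<open>Re\<close> and \<open>qre\<close> can be used for the explicit bases.\<close>

definition real_basis :: "nat \<Rightarrow> (nat \<Rightarrow> 'a::{real_algebra_1,conjugate}) \<Rightarrow> ('a \<Rightarrow> real) \<Rightarrow> bool" where
  "real_basis d e \<rho> \<longleftrightarrow> (\<forall>x. (\<Sum>a<d. \<rho> (conjugate (e a) * x) *\<^sub>R e a) = x) \<and>
     (\<forall>a<d. \<forall>b<d. \<rho> (conjugate (e a) * e b) = (if a = b then 1 else 0))"

text \<open>The basis is pulled back along the isomorphism. Inner products survive because
  \<open>rpart\<close> and \<rho> after f are both half of x + conjugate x.\<close>

lemma real_basis_transfer:
  fixes f :: "'g::real_complex_quat \<Rightarrow> 'b::{real_algebra_1,conjugate}"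
  assumes f: "star_algebra_iso (+) (*) (*\<^sub>R) conjugate f"
    and \<rho>: "\<And>y :: 'b. y + conjugate y = of_real (2 * \<rho> y)"
    and e: "real_basis d e \<rho>"
  shows "real_basis d (\<lambda>a. inv_into UNIV f (e a)) rpart"
proof -
  have inj: "x = y \<longleftrightarrow> f x = f y" for x y
    using f by (auto simp: star_algebra_iso_def bij_def inj_def)
  have inv [simp]: "f (inv_into UNIV f y) = y" for y
    using f by (simp add: star_algebra_iso_def bij_def surj_f_inv_f)
  have f0: "f 0 = 0"
    using f unfolding star_algebra_iso_def by (metis scaleR_zero_left)
  have fs: "f (sum g {..<d}) = (\<Sum>a<d. f (g a))" for g and d :: nat
    using f by (induct d) (auto simp: f0 star_algebra_iso_def)
  have r: "rpart x = \<rho> (f x)" for x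
  proof (rule rpart_eqI)
    show "x + conjugate x = of_real (2 * \<rho> (f x))"
      using f \<rho>[of "f x"] star_algebra_iso_one[OF f]
      by (simp add: inj star_algebra_iso_def of_real_def)
  qed
  show ?thesis
    using f e by (simp add: real_basis_def inj[of "sum _ _"] fs r star_algebra_iso_def)
qed

lemma real_basis_exists:
  "\<exists>d (e :: nat \<Rightarrow> 'g::real_complex_quat). real_basis d e rpart"
proof -
  consider (r) f :: "'g \<Rightarrow> real" where "star_algebra_iso (+) (*) (*\<^sub>R) conjugate f"
    | (c) f :: "'g \<Rightarrow> complex" where "star_algebra_iso (+) (*) (*\<^sub>R) conjugate f"
    | (q) f :: "'g \<Rightarrow> quat" where "star_algebra_iso (+) (*) (*\<^sub>R) conjugate f"
    using real_complex_or_quat by blast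
  then show ?thesis
  proof cases
    case r
    have "real_basis 1 (\<lambda>_. 1) (\<lambda>x::real. x)"
      by (simp add: real_basis_def)
    from real_basis_transfer[OF r _ this] show ?thesis by fastforce
  next
    case c
    have "real_basis 2 (\<lambda>a. if a = 0 then 1 else \<i>) Re"
      by (auto simp: real_basis_def numeral_2_eq_2 conjugate_complex_def complex_eq_iff less_Suc_eq)
    from real_basis_transfer[OF c _ this] show ?thesis
      by (fastforce simp: complex_eq_iff conjugate_complex_def)
  next
    case q
    define e where "e = (\<lambda>a::nat. if a = 0 then Quat 1 0 0 0 else if a = 1 then Quat 0 1 0 0
      else if a = 2 then Quat 0 0 1 0 else Quat 0 0 0 1)"
    have 4: "{..<4::nat} = {0, 1, 2, 3}" by auto
    have a4: "a < 4 \<longleftrightarrow> a = 0 \<or> a = 1 \<or> a = 2 \<or> a = 3" for a :: nat by auto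
    have "real_basis 4 e qre"
      unfolding real_basis_def a4 by (auto simp: 4 e_def quat_ops)
    moreover have "y + conjugate y = of_real (2 * qre y)" for y :: quat
      by (simp add: quat_ops of_real_def)
    ultimately show ?thesis
      using real_basis_transfer[OF q] by blast
  qed
qed

section \<open>Eigenvectors of Hermitian matrices\<close>

text \<open>A complex eigenvector exists, symmetry makes its eigenvalue real, and its real or
  imaginary part is then a nonzero real eigenvector. The index set is arbitrary because it will
  consist of pairs of a matrix index and a coordinate.\<close>

lemma symmetric_eigenvector:
  fixes B :: "'i \<Rightarrow> 'i \<Rightarrow> real"
  assumes fin: "finite I" and ne: "I \<noteq> {}"
    and sym: "\<And>p q. p \<in> I \<Longrightarrow> q \<in> I \<Longrightarrow> B p q = B q p"
  shows "\<exists>l c. (\<exists>p\<in>I. c p \<noteq> 0) \<and> (\<forall>p\<in>I. (\<Sum>q\<in>I. B p q * c q) = l * c p)"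
proof -
  obtain h where h: "bij_betw h {0..<card I} I"
    using ex_bij_betw_nat_finite[OF fin] by blast
  define N where "N = card I"
  have h: "bij_betw h {0..<N} I" and N: "N > 0"
    using h fin ne by (auto simp: N_def card_gt_0_iff)
  have hI: "h i \<in> I" if "i < N" for i
    using h that by (auto simp: bij_betw_def)
  define M where "M = mat N N (\<lambda>(i, j). complex_of_real (B (h i) (h j)))"
  have M: "M \<in> carrier_mat N N" by (simp add: M_def)
  obtain l v where "eigenvector M v l"
    using spectrum_non_empty[OF M N] by (auto simp: spectrum_def eigenvalue_def)
  then have v: "v \<in> carrier_vec N" "v \<noteq> 0\<^sub>v N" "M *\<^sub>v v = l \<cdot>\<^sub>v v"
    using M by (auto simp: eigenvector_def)
  have ev: "(\<Sum>j\<in>{0..<N}. of_real (B (h i) (h j)) * v $ j) = l * v $ i" if "i < N" for i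
  proof -
    have "(M *\<^sub>v v) $ i = (\<Sum>j\<in>{0..<N}. of_real (B (h i) (h j)) * v $ j)"
      using that v(1) by (simp add: M_def scalar_prod_def)
    then show ?thesis using that v by simp
  qed
  \<comment> \<open>\<open>s\<close> is the Hermitian form of M at v. It equals l times the positive
    real \<open>r\<close>, and exchanging the two summations shows that it is its own complex
    conjugate; hence l is real.\<close>
  define s where "s = (\<Sum>i\<in>{0..<N}. cnj (v $ i) * (l * v $ i))"
  define r where "r = (\<Sum>i\<in>{0..<N}. (cmod (v $ i))\<^sup>2)"
  obtain i0 where i0: "i0 < N" "v $ i0 \<noteq> 0"
    using v(1,2) by (metis carrier_vecD eq_vecI index_zero_vec)
  have r: "r \<noteq> 0"
    unfolding r_def using i0 by (subst sum_nonneg_eq_0_iff) auto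
  have s: "s = l * of_real r"
    by (simp add: s_def r_def sum_distrib_left algebra_simps flip: complex_norm_square)
  have s': "s = (\<Sum>i\<in>{0..<N}. \<Sum>j\<in>{0..<N}. of_real (B (h i) (h j)) * (cnj (v $ i) * v $ j))"
    unfolding s_def
  proof (rule sum.cong[OF refl])
    fix i assume "i \<in> {0..<N}"
    then have "cnj (v $ i) * (l * v $ i) =
        cnj (v $ i) * (\<Sum>j\<in>{0..<N}. of_real (B (h i) (h j)) * v $ j)"
      by (simp only: ev atLeastLessThan_iff)
    also have "\<dots> = (\<Sum>j\<in>{0..<N}. of_real (B (h i) (h j)) * (cnj (v $ i) * v $ j))"
      by (simp only: sum_distrib_left mult.left_commute)
    finally show "cnj (v $ i) * (l * v $ i) =
        (\<Sum>j\<in>{0..<N}. of_real (B (h i) (h j)) * (cnj (v $ i) * v $ j))" .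
  qed
  have "cnj s = s"
    unfolding s' by (subst (2) sum.swap) (auto intro!: sum.cong simp: sym hI)
  then have "cnj l = l"
    using r by (simp add: s)
  then have l: "l = of_real (Re l)"
    by (simp add: complex_eq_iff)
  \<comment> \<open>A real matrix with a real eigenvalue acts separately on real and imaginary
    parts; the part that does not vanish at \<open>i0\<close> is taken.\<close>
  define w where "w = (if Re (v $ i0) \<noteq> 0 then (\<lambda>i. Re (v $ i)) else (\<lambda>i. Im (v $ i)))"
  have w0: "w i0 \<noteq> 0"
    using i0 by (auto simp: w_def complex_eq_iff)
  have w: "(\<Sum>j\<in>{0..<N}. B (h i) (h j) * w j) = Re l * w i" if "i < N" for i
  proof -
    have "(\<Sum>j\<in>{0..<N}. of_real (B (h i) (h j)) * v $ j) = of_real (Re l) * v $ i"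
      using ev[OF that] l by simp
    then show ?thesis
      by (simp add: complex_eq_iff w_def)
  qed
  define c where "c p = w (inv_into {0..<N} h p)" for p
  have ch: "c (h i) = w i" if "i < N" for i
    using h that by (simp add: c_def bij_betw_def inv_into_f_f)
  have "(\<Sum>q\<in>I. B p q * c q) = Re l * c p" if p: "p \<in> I" for p
  proof -
    obtain i where i: "i < N" "p = h i"
      using h p by (auto simp: bij_betw_def)
    have "(\<Sum>q\<in>I. B p q * c q) = (\<Sum>j\<in>{0..<N}. B p (h j) * c (h j))"
      using h by (rule sum.reindex_bij_betw[symmetric])
    also have "\<dots> = Re l * c p"
      using i w[OF i(1)] by (simp add: ch)
    finally show ?thesis .
  qed
  moreover have "\<exists>p\<in>I. c p \<noteq> 0"
    using w0 i0 ch hI by (intro bexI[of _ "h i0"]) auto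
  ultimately show ?thesis by blast
qed

text \<open>In real coordinates a Hermitian matrix acts as a real symmetric one.\<close>

lemma hermitian_eigenvector:
  fixes b :: "'i \<Rightarrow> 'i \<Rightarrow> 'g::real_complex_quat"
  assumes fin: "finite S" and ne: "S \<noteq> {}"
    and herm: "\<And>i j. i \<in> S \<Longrightarrow> j \<in> S \<Longrightarrow> conjugate (b i j) = b j i"
  shows "\<exists>l x. (\<exists>i\<in>S. x i \<noteq> 0) \<and> (\<forall>i\<in>S. (\<Sum>j\<in>S. b i j * x j) = of_real l * x i)"
proof -
  obtain d and e :: "nat \<Rightarrow> 'g" where "real_basis d e rpart"
    using real_basis_exists by blast
  then have expand: "(\<Sum>a<d. rpart (conjugate (e a) * y) *\<^sub>R e a) = y"
    and ortho: "a < d \<Longrightarrow> a' < d \<Longrightarrow> rpart (conjugate (e a) * e a') = (if a = a' then 1 else 0)"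
    for y a a'
    by (auto simp: real_basis_def)
  \<comment> \<open>The matrix of left multiplication by b in the real orthonormal basis: its
    entries are the coordinates of b applied to the basis scalars.\<close>
  define B where "B p q = rpart (conjugate (e (snd p)) * b (fst p) (fst q) * e (snd q))" for p q
  define I where "I = S \<times> {..<d}"
  have "d > 0"
    using expand[of 1] by (cases d) auto
  then have "I \<noteq> {}" "finite I"
    using fin ne by (auto simp: I_def)
  \<comment> \<open>The real part is unchanged by conjugation, which reverses the product and turns
    b i j into b j i.\<close>
  moreover have "B p q = B q p" if "p \<in> I" "q \<in> I" for p q
  proof -
    have "B p q = rpart (conjugate (conjugate (e (snd p)) * b (fst p) (fst q) * e (snd q)))"
      by (simp only: B_def rpart_conj)
    also have "\<dots> = B q p"
      using that by (simp add: conj_mult B_def I_def mem_Times_iff herm mult.assoc)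
    finally show ?thesis .
  qed
  ultimately obtain l c where c: "\<exists>p\<in>I. c p \<noteq> 0"
    and ev: "\<And>p. p \<in> I \<Longrightarrow> (\<Sum>q\<in>I. B p q * c q) = l * c p"
    using symmetric_eigenvector[of I B] by blast
  define x where "x i = (\<Sum>a<d. c (i, a) *\<^sub>R e a)" for i
  have coord: "rpart (conjugate (e a) * x i) = c (i, a)" if "a < d" for i a
    using that
    by (simp add: x_def sum_distrib_left rpart_sum rpart_scaleR ortho if_distrib[of "\<lambda>u. _ * u"]
        cong: if_cong)
  have "(\<Sum>j\<in>S. b i j * x j) = of_real l * x i" if i: "i \<in> S" for i
  proof -
    have "rpart (conjugate (e a) * (\<Sum>j\<in>S. b i j * x j)) = l * c (i, a)" if a: "a < d" for a
    proof -
      have "rpart (conjugate (e a) * (\<Sum>j\<in>S. b i j * x j))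
          = (\<Sum>j\<in>S. \<Sum>a'<d. B (i, a) (j, a') * c (j, a'))"
        by (simp add: x_def sum_distrib_left rpart_sum rpart_scaleR B_def mult.assoc mult.commute)
      also have "\<dots> = l * c (i, a)"
        using ev[of "(i, a)"] i a by (simp add: I_def sum.cartesian_product case_prod_unfold)
      finally show ?thesis .
    qed
    then have "(\<Sum>j\<in>S. b i j * x j) = (\<Sum>a<d. (l * c (i, a)) *\<^sub>R e a)"
      by (subst expand[symmetric]) simp
    then show ?thesis
      by (simp add: x_def scaleR_sum_right flip: scaleR_conv_of_real)
  qed
  moreover have "\<exists>i\<in>S. x i \<noteq> 0"
  proof -
    obtain i a where "i \<in> S" "a < d" "c (i, a) \<noteq> 0"
      using c by (auto simp: I_def)
    then show ?thesis using coord[of a i] by (metis mult_zero_right rpart_0)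
  qed
  ultimately show ?thesis by blast
qed

text \<open>Right multiplication by a scalar q commutes with the action of b and with the real
  eigenvalue, so q is free to fix both the length and the phase of entry m. A real nonnegative entry
  m is what the reflection below needs.\<close>

lemma hermitian_unit_eigenvector:
  fixes b :: "'i \<Rightarrow> 'i \<Rightarrow> 'g::real_complex_quat"
  assumes fin: "finite S" and m: "m \<in> S"
    and herm: "\<And>i j. i \<in> S \<Longrightarrow> j \<in> S \<Longrightarrow> conjugate (b i j) = b j i"
  shows "\<exists>l x t. (\<Sum>i\<in>S. conjugate (x i) * x i) = 1 \<and> x m = of_real t \<and> t \<ge> 0 \<and>
    (\<forall>i\<in>S. (\<Sum>j\<in>S. b i j * x j) = of_real l * x i)"
proof -
  obtain l x where x: "\<exists>i\<in>S. x i \<noteq> 0"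
    and ev: "\<And>i. i \<in> S \<Longrightarrow> (\<Sum>j\<in>S. b i j * x j) = of_real l * x i"
    using hermitian_eigenvector[of S b] fin m herm by blast
  define N where "N = (\<Sum>i\<in>S. sqnorm (x i))"
  obtain i where i: "i \<in> S" "x i \<noteq> 0"
    using x by blast
  then have "sqnorm (x i) > 0"
    by (simp add: less_le sqnorm_ge_0 sqnorm_eq_0_iff)
  with fin i(1) have N: "N > 0"
    unfolding N_def by (intro sum_pos2[of S i]) (auto simp: sqnorm_ge_0)
  \<comment> \<open>If entry m is nonzero, q is its conjugate divided by its modulus and by the norm
    of x, so the product is modulus over norm. If it is zero, real normalization suffices and t =
    0.\<close>
  obtain q t where q: "conjugate q * q = of_real (1 / N)" and t: "x m * q = of_real t" "t \<ge> 0"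
  proof (cases "x m = 0")
    case True
    show ?thesis
      using N True by (intro that[of "of_real (1 / sqrt N)" 0]) (simp_all flip: of_real_mult)
  next
    case False
    define s where "s = sqnorm (x m)"
    have s: "s > 0"
      using False by (simp add: s_def less_le sqnorm_ge_0 sqnorm_eq_0_iff)
    define r where "r = 1 / (sqrt s * sqrt N)"
    have r: "r * (r * s) = 1 / N"
      using s N by (simp add: r_def field_simps)
    show ?thesis
    proof (rule that[of "r *\<^sub>R conjugate (x m)" "r * s"])
      show "conjugate (r *\<^sub>R conjugate (x m)) * (r *\<^sub>R conjugate (x m)) = of_real (1 / N)"
        by (simp add: conj_scaleR mult_conj_self of_real_def r flip: s_def)
      show "x m * (r *\<^sub>R conjugate (x m)) = of_real (r * s)"
        by (simp add: mult_conj_self of_real_def flip: s_def)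
    qed (use s N in \<open>simp add: r_def\<close>)
  qed
  have "(\<Sum>i\<in>S. conjugate (x i * q) * (x i * q)) = conjugate q * (\<Sum>i\<in>S. conjugate (x i) * x i) * q"
    by (simp add: conj_mult sum_distrib_left sum_distrib_right mult.assoc)
  also have "\<dots> = conjugate q * of_real N * q"
    by (simp add: N_def conj_mult_self)
  also have "\<dots> = of_real N * (conjugate q * q)"
    by (simp add: of_real_commute[of N] mult.assoc)
  also have "\<dots> = 1"
    using N by (simp add: q flip: of_real_mult)
  finally have "(\<Sum>i\<in>S. conjugate (x i * q) * (x i * q)) = 1" .
  moreover have "(\<Sum>j\<in>S. b i j * (x j * q)) = of_real l * (x i * q)" if "i \<in> S" for i
  proof -
    have "(\<Sum>j\<in>S. b i j * (x j * q)) = (\<Sum>j\<in>S. b i j * x j) * q"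
      by (simp add: sum_distrib_right mult.assoc)
    then show ?thesis using ev[OF that] by (simp add: mult.assoc)
  qed
  ultimately show ?thesis
    using t by (intro exI[of _ l] exI[of _ "\<lambda>i. x i * q"] exI[of _ t]) auto
qed

section \<open>Unitary matrices\<close>

lemma index_mult_mat_sum:
  assumes "A \<in> carrier_mat a b" "B \<in> carrier_mat b c" "i < a" "j < c"
  shows "(A * B) $$ (i, j) = (\<Sum>k<b. A $$ (i, k) * B $$ (k, j))"
  using assms by (auto simp: scalar_prod_def atLeast0LessThan intro: sum.cong)

lemma index_mult_mat_vec_sum:
  assumes "A \<in> carrier_mat a b" "v \<in> carrier_vec b" "i < a"
  shows "(A *\<^sub>v v) $ i = (\<Sum>k<b. A $$ (i, k) * v $ k)"
  using assms by (auto simp: scalar_prod_def atLeast0LessThan intro: sum.cong)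

lemma adj_carrier [simp]: "A \<in> carrier_mat a b \<Longrightarrow> adj A \<in> carrier_mat b a"
  by (simp add: adj_def)

lemma adj_index [simp]: "i < dim_col A \<Longrightarrow> j < dim_row A \<Longrightarrow> adj A $$ (i, j) = conjugate (A $$ (j, i))"
  by (simp add: adj_def)

lemma adj_dim [simp]: "dim_row (adj A) = dim_col A" "dim_col (adj A) = dim_row A"
  by (simp_all add: adj_def)

lemma adj_adj [simp]: "adj (adj A) = A"
  by (intro eq_matI) auto

text \<open>Conjugation reverses each product of entries, which restores the order that
  transposition upsets. Over the quaternions neither operation has such a rule alone.\<close>

lemma adj_mult:
  fixes A B :: "'g::real_complex_quat mat"
  assumes "A \<in> carrier_mat a b" "B \<in> carrier_mat b c"
  shows "adj (A * B) = adj B * adj A"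
  using assms
  by (intro eq_matI)
    (auto simp: index_mult_mat_sum[of _ a b _ c] index_mult_mat_sum[of _ c b _ a] conj_sum conj_mult
      simp del: index_mult_mat(1) intro!: sum.cong)

lemma hermitian_index:
  assumes "hermitian A" "A \<in> carrier_mat n n" "i < n" "j < n"
  shows "conjugate (A $$ (i, j)) = A $$ (j, i)"
  using assms by (metis adj_index carrier_matD hermitian_def)

lemma hermitian_congruence:
  fixes A :: "'g::real_complex_quat mat"
  assumes "hermitian A" "A \<in> carrier_mat n n" "X \<in> carrier_mat n k"
  shows "hermitian (adj X * A * X)"
  using assms by (simp add: hermitian_def adj_mult[of _ k n _ k] adj_mult[of _ n n _ k]
      assoc_mult_mat[of _ k n _ n _ k])

lemma congruence_mult:
  fixes A :: "'g::real_complex_quat mat"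
  assumes A: "A \<in> carrier_mat n n" and X: "X \<in> carrier_mat n k" and Y: "Y \<in> carrier_mat k l"
  shows "adj (X * Y) * A * (X * Y) = adj Y * (adj X * A * X) * Y"
proof -
  have XA: "adj X * A \<in> carrier_mat k n"
    using A X by (meson adj_carrier mult_carrier_mat)
  have "adj (X * Y) * A * (X * Y) = (adj Y * (adj X * A)) * (X * Y)"
    by (simp only: adj_mult[OF X Y] assoc_mult_mat[OF adj_carrier[OF Y] adj_carrier[OF X] A])
  also have "\<dots> = adj Y * ((adj X * A) * (X * Y))"
    by (rule assoc_mult_mat[OF adj_carrier[OF Y] XA mult_carrier_mat[OF X Y]])
  also have "\<dots> = adj Y * (((adj X * A) * X) * Y)"
    by (simp only: assoc_mult_mat[OF XA X Y])
  also have "\<dots> = adj Y * (adj X * A * X) * Y"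
    by (rule assoc_mult_mat[OF adj_carrier[OF Y] mult_carrier_mat[OF XA X] Y, symmetric])
  finally show ?thesis .
qed

definition unitary_mat :: "nat \<Rightarrow> 'a::{ring_1,conjugate} mat \<Rightarrow> bool" where
  "unitary_mat n U \<longleftrightarrow> U \<in> carrier_mat n n \<and> adj U * U = 1\<^sub>m n \<and> U * adj U = 1\<^sub>m n"

lemma mat_mult_cancel_middle:
  fixes A :: "'a::ring_1 mat"
  assumes "A \<in> carrier_mat a n" "B \<in> carrier_mat n m" "C \<in> carrier_mat m n" "D \<in> carrier_mat n b"
    and "B * C = 1\<^sub>m n"
  shows "(A * B) * (C * D) = A * D"
proof -
  have "(A * B) * (C * D) = A * ((B * C) * D)"
    using assms(1-4) by (simp add: assoc_mult_mat[of _ a n _ m _ b] assoc_mult_mat[of _ n m _ n _ b])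
  then show ?thesis using assms by simp
qed

lemma unitary_mat_mult:
  fixes U V :: "'g::real_complex_quat mat"
  assumes "unitary_mat n U" "unitary_mat n V"
  shows "unitary_mat n (U * V)"
  using assms
  by (auto simp: unitary_mat_def adj_mult[of _ n n _ n] mat_mult_cancel_middle[of _ n n _ n _ _ n]
      simp del: assoc_mult_mat)

text \<open>For \<open>t \<ge> 0\<close> the vector \<open>w = x + e\<^sub>m\<close> has squared length \<open>2 (1 + t) > 0\<close>, and the reflection
  \<open>2 w w\<^sup>* / (w\<^sup>* w) - 1\<close> exchanges \<open>e\<^sub>m\<close> and \<open>x\<close>.\<close>

lemma householder:
  fixes x :: "nat \<Rightarrow> 'g::real_complex_quat"
  assumes m: "m < n" and unit: "(\<Sum>i<n. conjugate (x i) * x i) = 1"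
    and t: "x m = of_real t" "t \<ge> 0"
  shows "\<exists>H \<in> carrier_mat n n. adj H = H \<and> H * H = 1\<^sub>m n \<and> (\<forall>i<n. H $$ (i, m) = x i) \<and>
    (\<forall>i<n. \<forall>j<n. (x i = 0 \<and> i \<noteq> m) \<or> (x j = 0 \<and> j \<noteq> m) \<longrightarrow> H $$ (i, j) = (if i = j then - 1 else 0))"
proof -
  define w where "w i = x i + (if i = m then 1 else 0)" for i
  \<comment> \<open>This is 2 divided by the squared length 2 + 2 t of w.\<close>
  define c where "c = 1 / (1 + t)"
  have c1: "c * (1 + t) = 1"
    using t(2) by (simp add: c_def)
  have c2: "c * (c * (2 + 2 * t)) = 2 * c"
    using arg_cong[OF c1, of "\<lambda>u. 2 * c * u"] by (simp add: algebra_simps)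
  define H where "H = mat n n (\<lambda>(i, j). c *\<^sub>R (w i * conjugate (w j)) - (if i = j then 1 else 0))"
  have H: "H \<in> carrier_mat n n" by (simp add: H_def)
  have w: "conjugate (w i) * w i = conjugate (x i) * x i + (if i = m then of_real (2 * t + 1) else 0)" for i
  proof (cases "i = m")
    case True
    have "conjugate (w m) * w m = of_real ((t + 1) * (t + 1))"
      by (simp only: w_def t(1) conj_add conj_of_real conj_1 of_real_mult of_real_add of_real_1
          simp_thms if_True)
    also have "(t + 1) * (t + 1) = t * t + (2 * t + 1)"
      by (simp add: algebra_simps)
    finally show ?thesis
      by (simp only: True t(1) conj_of_real of_real_mult of_real_add[of "t * t"] simp_thms if_True)
  qed (simp add: w_def)
  have ww: "(\<Sum>i<n. conjugate (w i) * w i) = of_real (2 + 2 * t)"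
    using m by (simp add: w sum.distrib unit)
  have "adj H = H"
    by (intro eq_matI) (auto simp: H_def conj_diff conj_scaleR conj_mult)
  moreover have "H * H = 1\<^sub>m n"
  proof (rule eq_matI)
    fix i j assume "i < dim_row (1\<^sub>m n)" "j < dim_col (1\<^sub>m n)"
    then have ij: "i < n" "j < n" by auto
    \<comment> \<open>Expansion of the square of c w adj w - 1. The inner sum is the real number 2 +
      2 t, so the quadratic term becomes 2 c w adj w and cancels the two mixed terms.\<close>
    have "(H * H) $$ (i, j) = (\<Sum>k<n. (c * c) *\<^sub>R (w i * (conjugate (w k) * w k) * conjugate (w j))
       - (if k = i then c *\<^sub>R (w k * conjugate (w j)) else 0)
       - (if k = j then c *\<^sub>R (w i * conjugate (w k)) else 0)
       + (if k = i then (if i = j then 1 else 0) else 0))"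
      using ij by (subst index_mult_mat_sum[OF H H])
        (auto simp: H_def algebra_simps intro!: sum.cong)
    also have "\<dots> = (c * c) *\<^sub>R (w i * (\<Sum>k<n. conjugate (w k) * w k) * conjugate (w j))
       - c *\<^sub>R (w i * conjugate (w j)) - c *\<^sub>R (w i * conjugate (w j)) + (if i = j then 1 else 0)"
      using ij by (simp add: sum.distrib sum_subtractf sum_distrib_left sum_distrib_right
          scaleR_sum_right)
    also have "\<dots> = (c * (c * (2 + 2 * t))) *\<^sub>R (w i * conjugate (w j))
       - (2 * c) *\<^sub>R (w i * conjugate (w j)) + (if i = j then 1 else 0)"
    proof -
      have "(2 * c) *\<^sub>R v = c *\<^sub>R v + c *\<^sub>R v" for v :: 'g
        by (simp flip: scaleR_add_left)
      then show ?thesis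
        unfolding ww by (simp add: of_real_def mult.assoc)
    qed
    also have "\<dots> = 1\<^sub>m n $$ (i, j)"
      using ij by (simp add: c2)
    finally show "(H * H) $$ (i, j) = 1\<^sub>m n $$ (i, j)" .
  qed (use H in auto)
  \<comment> \<open>Entry m of w is the real number 1 + t, the inverse of c. Column m of c w adj w
    is therefore w, and subtracting 1 on the diagonal leaves x.\<close>
  moreover have "H $$ (i, m) = x i" if "i < n" for i
  proof -
    have "c *\<^sub>R (w i * conjugate (w m)) = (c * (1 + t)) *\<^sub>R w i"
      by (simp add: w_def[of m] t(1) conj_add conj_scaleR distrib_left scaleR_add_left of_real_def algebra_simps)
    then show ?thesis
      using m that by (simp add: H_def c1) (simp add: w_def)
  qed
  \<comment> \<open>Off the support of w only the term -1 survives; hence the sign on untouched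
    indices.\<close>
  moreover have "H $$ (i, j) = (if i = j then - 1 else 0)"
    if "i < n" "j < n" "(x i = 0 \<and> i \<noteq> m) \<or> (x j = 0 \<and> j \<noteq> m)" for i j
    using that by (auto simp: H_def w_def)
  ultimately show ?thesis using H by blast
qed

section \<open>Simultaneous diagonalization\<close>

text \<open>Block diagonality along the level sets of \<open>d\<close>. These need not be intervals,
  so the eigenvalue list used as \<open>d\<close> need not be sorted.\<close>

definition blocks :: "(nat \<Rightarrow> 'b) \<Rightarrow> 'a::zero mat \<Rightarrow> bool" where
  "blocks d X \<longleftrightarrow> (\<forall>i<dim_row X. \<forall>j<dim_col X. d i \<noteq> d j \<longrightarrow> X $$ (i, j) = 0)"

lemma blocksD: "blocks d X \<Longrightarrow> X \<in> carrier_mat n n \<Longrightarrow> i < n \<Longrightarrow> j < n \<Longrightarrow> d i \<noteq> d j \<Longrightarrow> X $$ (i, j) = 0"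
  by (auto simp: blocks_def)

lemma blocks_mult:
  fixes X Y :: "'a::ring_1 mat"
  assumes "X \<in> carrier_mat n n" "Y \<in> carrier_mat n n" "blocks d X" "blocks d Y"
  shows "blocks d (X * Y)"
  unfolding blocks_def
proof (intro allI impI)
  fix i j assume ij: "i < dim_row (X * Y)" "j < dim_col (X * Y)" "d i \<noteq> d j"
  then have "(X * Y) $$ (i, j) = (\<Sum>k<n. X $$ (i, k) * Y $$ (k, j))"
    using assms by (intro index_mult_mat_sum) auto
  also have "\<dots> = 0"
  proof (intro sum.neutral ballI)
    fix k assume "k \<in> {..<n}"
    then show "X $$ (i, k) * Y $$ (k, j) = 0"
      using ij assms blocksD[of d X n i k] blocksD[of d Y n k j] by (cases "d i = d k") auto
  qed
  finally show "(X * Y) $$ (i, j) = 0" .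
qed

lemma blocks_adj:
  fixes X :: "'g::real_complex_quat mat"
  shows "blocks d X \<Longrightarrow> blocks d (adj X)"
  unfolding blocks_def by (auto simp: conj_eq_0_iff)

text \<open>The unitary matrix diagonalizing the first \<open>m\<close> columns is extended by the reflection that
  moves \<open>e\<^sub>m\<close> to an eigenvector supported in the block of \<open>m\<close> and on the indices \<open>\<ge> m\<close>.\<close>

lemma hermitian_blocks_diagonalize:
  fixes B :: "'g::real_complex_quat mat"
  assumes B: "B \<in> carrier_mat n n" "hermitian B" "blocks d B" and "m \<le> n"
  shows "\<exists>U \<mu>. unitary_mat n U \<and> blocks d U \<and>
    (\<forall>i<n. \<forall>j<m. (adj U * B * U) $$ (i, j) = (if i = j then of_real (\<mu> j) else 0))"
  using \<open>m \<le> n\<close>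
proof (induction m)
  case 0
  have "adj (1\<^sub>m n) = (1\<^sub>m n :: 'g mat)"
    by (intro eq_matI) auto
  then show ?case
    by (intro exI[of _ "1\<^sub>m n"]) (auto simp: unitary_mat_def blocks_def)
next
  case (Suc m)
  then obtain U \<mu> where U: "unitary_mat n U" "blocks d U"
    and diag: "\<And>i j. i < n \<Longrightarrow> j < m \<Longrightarrow>
      (adj U * B * U) $$ (i, j) = (if i = j then of_real (\<mu> j) else 0)"
    by auto
  have m: "m < n" using Suc by simp
  have Uc: "U \<in> carrier_mat n n" using U by (simp add: unitary_mat_def)
  define M where "M = adj U * B * U"
  have M: "M \<in> carrier_mat n n" "hermitian M" "blocks d M"
    using B Uc U(2) by (auto simp: M_def hermitian_congruence intro!: blocks_mult blocks_adj)
  \<comment> \<open>What remains of the block of m. An eigenvector of M restricted to S, padded with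
    zeros, meets neither the finished columns nor the other blocks.\<close>
  define S where "S = {i. m \<le> i \<and> i < n \<and> d i = d m}"
  have S: "finite S" "m \<in> S" "S \<subseteq> {..<n}"
    using m by (auto simp: S_def)
  obtain l x0 t where x0: "(\<Sum>i\<in>S. conjugate (x0 i) * x0 i) = 1" "x0 m = of_real t" "t \<ge> 0"
    and ev: "\<And>i. i \<in> S \<Longrightarrow> (\<Sum>j\<in>S. M $$ (i, j) * x0 j) = of_real l * x0 i"
    using hermitian_unit_eigenvector[of S m "\<lambda>i j. M $$ (i, j)"] S hermitian_index[OF M(2,1)]
    by (smt (verit) lessThan_iff subsetD)
  define x where "x i = (if i \<in> S then x0 i else 0)" for i
  have sum_S: "(\<Sum>i<n. if i \<in> S then f i else 0) = (\<Sum>i\<in>S. f i)" for f :: "nat \<Rightarrow> 'g"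
    using S by (simp add: sum.If_cases Int_absorb1)
  have unit: "(\<Sum>i<n. conjugate (x i) * x i) = 1"
    using x0(1) sum_S[of "\<lambda>i. conjugate (x0 i) * x0 i"]
    by (simp add: x_def if_distrib[of "\<lambda>u. _ * u"] cong: if_cong)
  \<comment> \<open>Indices below m are decoupled because their columns are already diagonal and M
    is Hermitian; the other indices outside S lie in different blocks.\<close>
  have off: "M $$ (i, j) = 0" if "i < n" "i \<notin> S" "j \<in> S" for i j
  proof (cases "i < m")
    case True
    then have "M $$ (j, i) = 0"
      using that diag[of j i] by (auto simp: S_def M_def)
    then show ?thesis
      using that hermitian_index[OF M(2,1), of j i] S by auto
  next
    case False
    then show ?thesis
      using that by (intro blocksD[OF M(3,1)]) (auto simp: S_def)
  qed
  have evM: "(\<Sum>j<n. M $$ (i, j) * x j) = of_real l * x i" if "i < n" for i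
  proof -
    have "(\<Sum>j<n. M $$ (i, j) * x j) = (\<Sum>j\<in>S. M $$ (i, j) * x0 j)"
      using sum_S[of "\<lambda>j. M $$ (i, j) * x0 j"]
      by (simp add: x_def if_distrib[of "\<lambda>u. _ * u"] cong: if_cong)
    also have "\<dots> = of_real l * x i"
      using ev[of i] off[OF that] by (auto simp: x_def)
    finally show ?thesis .
  qed
  obtain H where H: "H \<in> carrier_mat n n" "adj H = H" "H * H = 1\<^sub>m n"
    and Hm: "\<And>i. i < n \<Longrightarrow> H $$ (i, m) = x i"
    and Hoff: "\<And>i j. i < n \<Longrightarrow> j < n \<Longrightarrow> i \<notin> S \<or> j \<notin> S \<Longrightarrow> H $$ (i, j) = (if i = j then - 1 else 0)"
    using householder[OF m unit] x0(2,3) S(2) unfolding x_def by (smt (verit))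
  have uH: "unitary_mat n H" using H by (simp add: unitary_mat_def)
  have bH: "blocks d H"
    unfolding blocks_def
  proof (intro allI impI)
    fix i j assume "i < dim_row H" "j < dim_col H" "d i \<noteq> d j"
    then show "H $$ (i, j) = 0"
      using H(1) Hoff[of i j] by (cases "i \<in> S") (auto simp: S_def)
  qed
  have HMH: "adj (U * H) * B * (U * H) = H * (M * H)"
    using congruence_mult[OF B(1) Uc H(1)] assoc_mult_mat[OF H(1) M(1) H(1)]
    by (simp only: H(2) M_def)
  have MH: "M * H \<in> carrier_mat n n" using M(1) H(1) by simp
  \<comment> \<open>Column m: x = H e_m and M x = l x, so H M H e_m = l H H e_m = l e_m. Columns j <
    m: H e_j = - e_j, and the two signs cancel.\<close>
  have "(H * (M * H)) $$ (i, j) = (if i = j then of_real ((\<mu>(m := l)) j) else 0)"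
    if i: "i < n" and j: "j < Suc m" for i j
  proof (cases "j = m")
    case True
    have MHm: "(M * H) $$ (k, m) = of_real l * H $$ (k, m)" if "k < n" for k
      using that m evM[OF that] by (simp add: index_mult_mat_sum[OF M(1) H(1)] Hm del: index_mult_mat(1))
    have "(H * (M * H)) $$ (i, m) = (\<Sum>k<n. H $$ (i, k) * (of_real l * H $$ (k, m)))"
      using i m MHm by (simp add: index_mult_mat_sum[OF H(1) MH] del: index_mult_mat(1))
    also have "\<dots> = of_real l * (H * H) $$ (i, m)"
      using i m by (simp add: index_mult_mat_sum[OF H(1) H(1)] sum_distrib_left of_real_commute[of l]
          mult.assoc del: index_mult_mat(1))
    finally show ?thesis
      using i m True by (simp add: H(3))
  next
    case False
    then have jm: "j < m" "j < n" "j \<notin> S" using j m by (auto simp: S_def)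
    have Hj: "H $$ (k, j) = (if k = j then - 1 else 0)" if "k < n" for k
      using jm Hoff[OF that, of j] by simp
    have MHj: "(M * H) $$ (k, j) = (if k = j then - of_real (\<mu> j) else 0)" if "k < n" for k
    proof -
      have "(M * H) $$ (k, j) = (\<Sum>k'<n. if k' = j then - M $$ (k, k') else 0)"
        unfolding index_mult_mat_sum[OF M(1) H(1) that jm(2)] by (intro sum.cong) (simp_all add: Hj)
      then show ?thesis
        using jm diag[OF that jm(1)] by (simp add: M_def)
    qed
    have "(H * (M * H)) $$ (i, j) = (\<Sum>k<n. if k = j then - H $$ (i, k) * of_real (\<mu> j) else 0)"
      unfolding index_mult_mat_sum[OF H(1) MH i jm(2)] by (intro sum.cong) (simp_all add: MHj)
    then show ?thesis
      using i jm by (simp add: Hj)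
  qed
  then show ?case
    using unitary_mat_mult[OF U(1) uH] blocks_mult[OF Uc H(1) U(2) bH]
    by (intro exI[of _ "U * H"] exI[of _ "\<mu>(m := l)"]) (simp only: HMH, simp)
qed

section \<open>Dual matrices\<close>

definition dual_mat :: "'a mat \<Rightarrow> 'a mat \<Rightarrow> 'a dual mat" where
  "dual_mat X Y = mat (dim_row X) (dim_col X) (\<lambda>ij. Dual (X $$ ij) (Y $$ ij))"

lemma dual_mat_carrier [simp]: "X \<in> carrier_mat a b \<Longrightarrow> dual_mat X Y \<in> carrier_mat a b"
  by (simp add: dual_mat_def)

lemma dual_mat_index:
  "i < dim_row X \<Longrightarrow> j < dim_col X \<Longrightarrow> dual_mat X Y $$ (i, j) = Dual (X $$ (i, j)) (Y $$ (i, j))"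
  by (simp add: dual_mat_def)

lemma sum_Dual: "(\<Sum>i\<in>I. Dual (f i) (g i)) = Dual (\<Sum>i\<in>I. f i) (\<Sum>i\<in>I. g i)"
  by (induct I rule: infinite_finite_induct) (auto simp: zero_dual_def plus_dual_def)

text \<open>The product Y Y' carries eps squared and disappears. Identities between dual matrices
  thus split into a standard and a first-order identity.\<close>

lemma dual_mat_mult:
  fixes X Y X' Y' :: "'a::ring_1 mat"
  assumes "X \<in> carrier_mat a b" "Y \<in> carrier_mat a b" "X' \<in> carrier_mat b c" "Y' \<in> carrier_mat b c"
  shows "dual_mat X Y * dual_mat X' Y' = dual_mat (X * X') (X * Y' + Y * X')"
proof (rule eq_matI)
  fix i j
  assume "i < dim_row (dual_mat (X * X') (X * Y' + Y * X'))"
    "j < dim_col (dual_mat (X * X') (X * Y' + Y * X'))"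
  then have ij: "i < a" "j < c"
    using assms by (auto simp: dual_mat_def)
  have "(dual_mat X Y * dual_mat X' Y') $$ (i, j) = (\<Sum>k<b. Dual (X $$ (i, k) * X' $$ (k, j))
      (X $$ (i, k) * Y' $$ (k, j) + Y $$ (i, k) * X' $$ (k, j)))"
    using assms ij
    by (subst index_mult_mat_sum[of _ a b _ c])
      (auto simp: dual_mat_index times_dual_def simp del: index_mult_mat(1) intro!: sum.cong)
  also have "\<dots> = dual_mat (X * X') (X * Y' + Y * X') $$ (i, j)"
    using assms ij
    by (simp add: dual_mat_index sum_Dual sum.distrib index_mult_mat_sum[of _ a b _ c]
        del: index_mult_mat(1))
  finally show "(dual_mat X Y * dual_mat X' Y') $$ (i, j)
      = dual_mat (X * X') (X * Y' + Y * X') $$ (i, j)" .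
qed (use assms in \<open>auto simp: dual_mat_def\<close>)

lemma adj_dual_mat:
  assumes "X \<in> carrier_mat a b" "Y \<in> carrier_mat a b"
  shows "adj (dual_mat X Y) = dual_mat (adj X) (adj Y)"
  using assms by (intro eq_matI) (auto simp: dual_mat_def conjugate_dual_def)

lemma one_mat_dual: "1\<^sub>m n = dual_mat (1\<^sub>m n) (0\<^sub>m n n :: 'a::ring_1 mat)"
  by (intro eq_matI) (auto simp: dual_mat_def one_dual_def zero_dual_def)

lemma dual_mat_mult_vec:
  fixes X Y :: "'a::ring_1 mat"
  assumes "X \<in> carrier_mat a b" "Y \<in> carrier_mat a b" "x \<in> carrier_vec b" "y \<in> carrier_vec b"
  shows "dual_mat X Y *\<^sub>v dual_vec x y = dual_vec (X *\<^sub>v x) (X *\<^sub>v y + Y *\<^sub>v x)"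
proof (rule eq_vecI)
  fix i assume "i < dim_vec (dual_vec (X *\<^sub>v x) (X *\<^sub>v y + Y *\<^sub>v x))"
  then have i: "i < a"
    using assms by (auto simp: dual_vec_def)
  have "(dual_mat X Y *\<^sub>v dual_vec x y) $ i
      = (\<Sum>k<b. Dual (X $$ (i, k) * x $ k) (X $$ (i, k) * y $ k + Y $$ (i, k) * x $ k))"
    using assms i
    by (subst index_mult_mat_vec_sum[of _ a b])
      (auto simp: dual_mat_index dual_vec_def times_dual_def simp del: index_mult_mat_vec intro!: sum.cong)
  also have "\<dots> = dual_vec (X *\<^sub>v x) (X *\<^sub>v y + Y *\<^sub>v x) $ i"
    using assms i
    by (simp add: dual_vec_def sum_Dual sum.distrib index_mult_mat_vec_sum[of _ a b]
        del: index_mult_mat_vec)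
  finally show "(dual_mat X Y *\<^sub>v dual_vec x y) $ i
      = dual_vec (X *\<^sub>v x) (X *\<^sub>v y + Y *\<^sub>v x) $ i" .
qed (use assms in \<open>auto simp: dual_mat_def dual_vec_def\<close>)

section \<open>Diagonalization of dual Hermitian matrices\<close>

definition diagonalizes :: "'g::real_complex_quat mat \<Rightarrow> 'g mat \<Rightarrow> real list \<Rightarrow> bool" where
  "diagonalizes U A es \<longleftrightarrow> unitary_mat (length es) U \<and> A \<in> carrier_mat (length es) (length es) \<and>
     adj U * A * U = diagonal_of (map of_real es)"

lemma eigenvalue_list_iff: "eigenvalue_list A es \<longleftrightarrow> (\<exists>U. diagonalizes U A es)"
  by (auto simp: eigenvalue_list_def unitarily_diagonalizes_to_def diagonalizes_def unitary_mat_def)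

lemma diagonal_of_carrier [simp]: "diagonal_of ds \<in> carrier_mat (length ds) (length ds)"
  by (simp add: diagonal_of_def)

lemma diagonal_of_index:
  "i < length ds \<Longrightarrow> j < length ds \<Longrightarrow> diagonal_of ds $$ (i, j) = (if i = j then ds ! i else 0)"
  by (simp add: diagonal_of_def)

lemma diagonal_of_mult_index:
  fixes X :: "'a::ring_1 mat"
  assumes "X \<in> carrier_mat (length ds) k" "i < length ds" "j < k"
  shows "(diagonal_of ds * X) $$ (i, j) = ds ! i * X $$ (i, j)"
proof -
  have "(diagonal_of ds * X) $$ (i, j)
      = (\<Sum>l<length ds. if l = i then ds ! i * X $$ (l, j) else 0)"
    unfolding index_mult_mat_sum[OF diagonal_of_carrier assms]
    using assms by (intro sum.cong) (auto simp: diagonal_of_index)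
  then show ?thesis using assms by simp
qed

lemma mult_diagonal_of_index:
  fixes X :: "'a::ring_1 mat"
  assumes "X \<in> carrier_mat k (length ds)" "i < k" "j < length ds"
  shows "(X * diagonal_of ds) $$ (i, j) = X $$ (i, j) * ds ! j"
proof -
  have "(X * diagonal_of ds) $$ (i, j)
      = (\<Sum>l<length ds. if l = j then X $$ (i, l) * ds ! j else 0)"
    unfolding index_mult_mat_sum[OF assms(1) diagonal_of_carrier assms(2,3)]
    using assms by (intro sum.cong) (auto simp: diagonal_of_index)
  then show ?thesis using assms by simp
qed

lemma index_congruence:
  fixes B V :: "'g::real_complex_quat mat"
  assumes B: "B \<in> carrier_mat n n" and V: "V \<in> carrier_mat n k" and ij: "i < k" "j < k"
  shows "(adj V * B * V) $$ (i, j) =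
    (\<Sum>l<n. \<Sum>l'<n. conjugate (V $$ (l', i)) * B $$ (l', l) * V $$ (l, j))"
proof -
  have VB: "adj V * B \<in> carrier_mat k n"
    by (rule mult_carrier_mat[OF adj_carrier[OF V] B])
  show ?thesis
    unfolding index_mult_mat_sum[OF VB V ij]
    using V ij by (intro sum.cong refl)
      (simp add: index_mult_mat_sum[OF adj_carrier[OF V] B ij(1)] sum_distrib_right)
qed

text \<open>In the double sum for entry (i, j) a term can be nonzero only if both summation indices
  lie in the common block of i and j. Entries of B outside the blocks are never seen.\<close>

lemma index_congruence_blocks:
  fixes B V :: "'g::real_complex_quat mat"
  assumes B: "B \<in> carrier_mat n n" "B' \<in> carrier_mat n n" and V: "V \<in> carrier_mat n n" "blocks d V"
    and eq: "\<And>i j. i < n \<Longrightarrow> j < n \<Longrightarrow> d i = d j \<Longrightarrow> B $$ (i, j) = B' $$ (i, j)"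
    and ij: "i < n" "j < n" "d i = d j"
  shows "(adj V * B * V) $$ (i, j) = (adj V * B' * V) $$ (i, j)"
  unfolding index_congruence[OF B(1) V(1) ij(1,2)] index_congruence[OF B(2) V(1) ij(1,2)]
proof (intro sum.cong refl)
  fix l l' assume "l \<in> {..<n}" "l' \<in> {..<n}"
  then have l: "l < n" "l' < n" by auto
  show "conjugate (V $$ (l', i)) * B $$ (l', l) * V $$ (l, j)
      = conjugate (V $$ (l', i)) * B' $$ (l', l) * V $$ (l, j)"
  proof (cases "d l' = d l")
    case True
    then show ?thesis using eq l by simp
  next
    case False
    then have "V $$ (l', i) = 0 \<or> V $$ (l, j) = 0"
      using blocksD[OF V(2,1)] l ij by metis
    then show ?thesis by auto
  qed
qed

text \<open>First-order perturbation theory: choosing the eigenbasis of \<open>A\<^sub>s\<close> so that \<open>C = U\<^sup>* A\<^sub>d U\<close> is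
  diagonal on every eigenspace, the rotation \<open>1 + P \<epsilon>\<close> with the skew-Hermitian matrix
  \<open>P\<^sub>i\<^sub>j = C\<^sub>i\<^sub>j / (e\<^sub>j - e\<^sub>i)\<close> removes the remaining entries, because \<open>(D P - P D)\<^sub>i\<^sub>j = (e\<^sub>i - e\<^sub>j) P\<^sub>i\<^sub>j\<close>.\<close>

lemma dual_diagonalization:
  fixes As Ad :: "'g::real_complex_quat mat"
  assumes As: "eigenvalue_list As es" and Ad: "Ad \<in> carrier_mat (length es) (length es)" "hermitian Ad"
  shows "\<exists>U \<mu>. diagonalizes U As es \<and>
    (\<forall>i<length es. (adj U * Ad * U) $$ (i, i) = of_real (\<mu> i)) \<and>
    dual_eigenvalue_list (dual_mat As Ad) (map (\<lambda>i. Dual (es ! i) (\<mu> i)) [0..<length es])"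
proof -
  define n where "n = length es"
  define D where "D = (diagonal_of (map of_real es) :: 'g mat)"
  have D: "D \<in> carrier_mat n n"
    using diagonal_of_carrier[of "map of_real es"] by (simp add: D_def n_def)
  have D_index: "D $$ (i, j) = (if i = j then of_real (es ! i) else 0)" if "i < n" "j < n" for i j
    using that by (simp add: D_def n_def diagonal_of_index)
  have D_left: "(D * X) $$ (i, j) = of_real (es ! i) * X $$ (i, j)"
    and D_right: "(X * D) $$ (i, j) = X $$ (i, j) * of_real (es ! j)"
    if "X \<in> carrier_mat n n" "i < n" "j < n" for X i j
    using that diagonal_of_mult_index[of X "map of_real es" n i j]
      mult_diagonal_of_index[of X n "map of_real es" i j] by (simp_all add: D_def n_def)
  obtain U0 where U0: "unitary_mat n U0" "adj U0 * As * U0 = D" and As: "As \<in> carrier_mat n n"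
    using As by (auto simp: eigenvalue_list_iff diagonalizes_def n_def D_def)
  have Ad': "Ad \<in> carrier_mat n n" using Ad by (simp add: n_def)
  have U0c: "U0 \<in> carrier_mat n n" using U0 by (simp add: unitary_mat_def)
  define B where "B = adj U0 * Ad * U0"
  have B: "B \<in> carrier_mat n n" "hermitian B"
    using U0c Ad' Ad(2) by (auto simp: B_def hermitian_congruence)
  \<comment> \<open>B is generally not block diagonal; truncating it to the eigenspaces of
    \<open>As\<close> gives a matrix to which the block diagonalization applies.\<close>
  define B' where "B' = mat n n (\<lambda>(i, j). if es ! i = es ! j then B $$ (i, j) else 0)"
  have B': "B' \<in> carrier_mat n n" "blocks ((!) es) B'"
    by (auto simp: B'_def blocks_def)
  have "hermitian B'"
    unfolding hermitian_def
    by (intro eq_matI) (auto simp: B'_def hermitian_index[OF B(2,1)])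
  then obtain V \<mu> where V: "unitary_mat n V" "blocks ((!) es) V"
    and \<mu>: "\<And>i j. i < n \<Longrightarrow> j < n \<Longrightarrow> (adj V * B' * V) $$ (i, j) = (if i = j then of_real (\<mu> j) else 0)"
    using hermitian_blocks_diagonalize[of B' n "(!) es" n] B' by auto
  have Vc: "V \<in> carrier_mat n n" using V by (simp add: unitary_mat_def)
  define U where "U = U0 * V"
  have U: "unitary_mat n U"
    unfolding U_def by (rule unitary_mat_mult[OF U0(1) V(1)])
  then have Uc: "U \<in> carrier_mat n n" by (simp add: unitary_mat_def)
  define C where "C = adj U * Ad * U"
  have C: "C \<in> carrier_mat n n" "hermitian C"
    using Uc Ad' Ad(2) by (auto simp: C_def hermitian_congruence)
  \<comment> \<open>D is a real scalar on each block of V, so the second change of basis leaves the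
    standard part diagonal.\<close>
  have "D * V = V * D"
  proof (rule eq_matI)
    fix i j assume "i < dim_row (V * D)" "j < dim_col (V * D)"
    then have ij: "i < n" "j < n" using Vc D by auto
    show "(D * V) $$ (i, j) = (V * D) $$ (i, j)"
      unfolding D_left[OF Vc ij] D_right[OF Vc ij]
      using blocksD[OF V(2) Vc ij] by (cases "es ! i = es ! j") (simp_all add: of_real_commute)
  qed (use Vc D in auto)
  then have "adj V * D * V = (adj V * V) * D"
    using Vc D by (simp add: assoc_mult_mat[of _ n n _ n _ n])
  then have UAU: "adj U * As * U = D"
    using V(1) D by (simp add: U_def congruence_mult[OF As U0c Vc] U0(2) unitary_mat_def)
  have CB: "C = adj V * B * V"
    by (simp only: C_def U_def B_def congruence_mult[OF Ad' U0c Vc])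
  have C_block: "C $$ (i, j) = (if i = j then of_real (\<mu> j) else 0)"
    if "i < n" "j < n" "es ! i = es ! j" for i j
    unfolding CB using that index_congruence_blocks[OF B(1) B'(1) Vc V(2), of i j] \<mu>[of i j]
    by (simp add: B'_def)
  \<comment> \<open>For equal eigenvalues the denominator vanishes and the entry is set to 0; V has
    already made these blocks of C diagonal.\<close>
  define P where "P = mat n n (\<lambda>(i, j). if es ! i = es ! j then 0
    else of_real (1 / (es ! j - es ! i)) * C $$ (i, j))"
  have P: "P \<in> carrier_mat n n" by (simp add: P_def)
  \<comment> \<open>This makes \<open>Q\<close> unitary: the dual part of \<open>adj Q * Q\<close>
    is P + adj P, and that of \<open>Q * adj Q\<close> is its conjugate by U. It holds because C is
    Hermitian while the real denominators change sign under transposition.\<close>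
  have skew: "P + adj P = 0\<^sub>m n n"
  proof (rule eq_matI)
    fix i j assume "i < dim_row (0\<^sub>m n n)" "j < dim_col (0\<^sub>m n n)"
    then have ij: "i < n" "j < n" by auto
    have "1 / (es ! i - es ! j) = - (1 / (es ! j - es ! i))"
      by (metis divide_minus_right minus_diff_eq)
    then have "of_real (1 / (es ! j - es ! i)) + of_real (1 / (es ! i - es ! j)) = (0 :: 'g)"
      by (simp only: of_real_minus add.right_inverse)
    then have "of_real (1 / (es ! j - es ! i)) * C $$ (i, j)
        + of_real (1 / (es ! i - es ! j)) * C $$ (i, j) = 0"
      by (simp only: distrib_right[symmetric] mult_zero_left)
    then show "(P + adj P) $$ (i, j) = 0\<^sub>m n n $$ (i, j)"
      using ij
      by (simp add: P_def conj_mult hermitian_index[OF C(2,1)] del: of_real_divide of_real_diff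
          flip: of_real_commute)
  qed (use P in auto)
  have commutator: "D * P + C + adj P * D = diagonal_of (map (\<lambda>i. of_real (\<mu> i)) [0..<n])"
    (is "_ = ?M")
  proof (rule eq_matI)
    fix i j assume "i < dim_row ?M" "j < dim_col ?M"
    then have ij: "i < n" "j < n" by (auto simp: diagonal_of_def)
    have skew_ij: "adj P $$ (i, j) = - P $$ (i, j)"
      using arg_cong[OF skew, of "\<lambda>X. X $$ (i, j)"] ij P by (simp add: add_eq_0_iff)
    have "(D * P + C + adj P * D) $$ (i, j)
        = of_real (es ! i) * P $$ (i, j) + C $$ (i, j) + - P $$ (i, j) * of_real (es ! j)"
      using ij P C(1) D D_left[OF P ij] D_right[OF adj_carrier[OF P] ij]
      by (simp del: index_mult_mat(1) adj_index add: skew_ij)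
    also have "\<dots> = ?M $$ (i, j)"
    proof (cases "es ! i = es ! j")
      case True
      then show ?thesis
        using ij C_block[OF ij] by (simp add: P_def diagonal_of_def)
    next
      case False
      have "of_real (es ! i) * P $$ (i, j) + - P $$ (i, j) * of_real (es ! j)
          = of_real (es ! i - es ! j) * P $$ (i, j)"
        by (simp add: left_diff_distrib of_real_commute[of "es ! j"])
      also have "\<dots> = of_real ((es ! i - es ! j) * (1 / (es ! j - es ! i))) * C $$ (i, j)"
        using ij False unfolding of_real_mult mult.assoc by (simp add: P_def)
      also have "(es ! i - es ! j) * (1 / (es ! j - es ! i)) = - 1"
        using False by (simp add: field_simps)
      finally show ?thesis
        using ij False by (auto simp: diagonal_of_def algebra_simps)
    qed
    finally show "(D * P + C + adj P * D) $$ (i, j) = ?M $$ (i, j)" .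
  qed (use P D C in \<open>auto simp: diagonal_of_def\<close>)
  \<comment> \<open>\<open>Q\<close> is U (1 + P eps), the unitary change of basis followed by the
    infinitesimal rotation.\<close>
  define Q where "Q = dual_mat U (U * P)"
  have UP: "U * P \<in> carrier_mat n n" using Uc P by simp
  have Q: "Q \<in> carrier_mat n n" using Uc by (simp add: Q_def)
  have adjUP: "adj (U * P) = adj P * adj U" by (rule adj_mult[OF Uc P])
  have adjQ: "adj Q = dual_mat (adj U) (adj P * adj U)"
    by (simp only: Q_def adj_dual_mat[OF Uc UP] adjUP)
  have cU: "adj U \<in> carrier_mat n n" "adj P \<in> carrier_mat n n" "adj P * adj U \<in> carrier_mat n n"
    using Uc P by auto
  have UU: "adj U * U = 1\<^sub>m n" "U * adj U = 1\<^sub>m n" using U by (auto simp: unitary_mat_def)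
  have "adj Q * Q = dual_mat (adj U * U) (adj U * (U * P) + adj P * adj U * U)"
    unfolding adjQ unfolding Q_def by (rule dual_mat_mult[OF cU(1,3) Uc UP])
  also have "adj U * (U * P) = P"
    using assoc_mult_mat[OF cU(1) Uc P] UU P by simp
  also have "adj P * adj U * U = adj P"
    by (simp only: assoc_mult_mat[OF cU(2,1) Uc] UU right_mult_one_mat[OF cU(2)])
  finally have QQ: "adj Q * Q = 1\<^sub>m n"
    by (simp only: skew UU one_mat_dual)
  have "Q * adj Q = dual_mat (U * adj U) (U * (adj P * adj U) + U * P * adj U)"
    unfolding adjQ unfolding Q_def by (rule dual_mat_mult[OF Uc UP cU(1,3)])
  also have "U * (adj P * adj U) + U * P * adj U = U * ((P + adj P) * adj U)"
    using Uc P cU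
    by (simp add: add_mult_distrib_mat[OF P cU(2,1)] mult_add_distrib_mat[of _ n n _ n]
        assoc_mult_mat[of _ n n _ n _ n] comm_add_mat[of _ n n])
  also have "\<dots> = 0\<^sub>m n n"
    unfolding skew using Uc cU by simp
  finally have QQ': "Q * adj Q = 1\<^sub>m n"
    by (simp only: UU one_mat_dual)
  have UA: "adj U * As \<in> carrier_mat n n" "adj U * Ad \<in> carrier_mat n n"
    "adj P * adj U * As \<in> carrier_mat n n"
    using mult_carrier_mat[OF cU(1) As] mult_carrier_mat[OF cU(1) Ad'] mult_carrier_mat[OF cU(3) As]
    by auto
  have "adj Q * dual_mat As Ad = dual_mat (adj U * As) (adj U * Ad + adj P * adj U * As)"
    unfolding adjQ by (rule dual_mat_mult[OF cU(1,3) As Ad'])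
  then have AQ: "adj Q * dual_mat As Ad * Q = dual_mat (adj U * As * U)
      (adj U * As * (U * P) + (adj U * Ad + adj P * adj U * As) * U)"
    unfolding Q_def using UA by (simp add: dual_mat_mult[OF UA(1) _ Uc UP])
  have DP: "adj U * As * (U * P) = D * P"
    using assoc_mult_mat[OF UA(1) Uc P] by (simp only: UAU)
  have PD: "adj P * adj U * As * U = adj P * D"
    by (simp only: assoc_mult_mat[OF cU(2,1) As] assoc_mult_mat[OF cU(2) UA(1) Uc] UAU)
  have "adj U * As * (U * P) + (adj U * Ad + adj P * adj U * As) * U = D * P + C + adj P * D"
    by (simp only: DP PD add_mult_distrib_mat[OF UA(2,3) Uc] C_def[symmetric]
        assoc_add_mat[OF mult_carrier_mat[OF D P] C(1) mult_carrier_mat[OF cU(2) D]])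
  with AQ have "adj Q * dual_mat As Ad * Q = dual_mat D (diagonal_of (map (\<lambda>i. of_real (\<mu> i)) [0..<n]))"
    by (simp only: UAU commutator)
  also have "\<dots> = diagonal_of (map (map_dual of_real) (map (\<lambda>i. Dual (es ! i) (\<mu> i)) [0..<n]))"
    by (intro eq_matI) (auto simp: dual_mat_def diagonal_of_def D_def n_def zero_dual_def)
  finally have "dual_eigenvalue_list (dual_mat As Ad) (map (\<lambda>i. Dual (es ! i) (\<mu> i)) [0..<n])"
    unfolding dual_eigenvalue_list_def unitarily_diagonalizes_to_def
    using Q QQ QQ' dual_mat_carrier[OF As] by auto
  moreover have "diagonalizes U As es"
    using U UAU As by (simp add: diagonalizes_def n_def D_def)
  moreover have "(adj U * Ad * U) $$ (i, i) = of_real (\<mu> i)" if "i < n" for i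
    using C_block[OF that that] by (simp add: C_def)
  ultimately show ?thesis
    unfolding n_def by blast
qed

section \<open>Solvability of the eigenvector equation\<close>

lemma card_count_list: "card {i. i < length xs \<and> xs ! i = y} = count_list xs y"
  by (simp add: count_list_eq_length_filter length_filter_conv_card eq_commute)

lemma cinner_sum:
  assumes "u \<in> carrier_vec n" "v \<in> carrier_vec n"
  shows "cinner u v = (\<Sum>i<n. conjugate (u $ i) * v $ i)"
  using assms by (auto simp: cinner_def scalar_prod_def conjugate_vec_def atLeast0LessThan)

lemma of_real_left_commute: "of_real r * (x * y) = x * (of_real r * y :: 'g::real_algebra_1)"
  by (simp add: of_real_def)

lemma shifted_mult_vec_index:
  fixes A :: "'g::real_complex_quat mat"
  assumes "A \<in> carrier_mat n n" "x \<in> carrier_vec n" "i < n"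
  shows "((of_real l \<cdot>\<^sub>m 1\<^sub>m n - A) *\<^sub>v x) $ i = of_real l * x $ i - (A *\<^sub>v x) $ i" (is ?l)
    and "((A - of_real l \<cdot>\<^sub>m 1\<^sub>m n) *\<^sub>v x) $ i = (A *\<^sub>v x) $ i - of_real l * x $ i" (is ?r)
proof -
  have d: "(\<Sum>k<n. (of_real l * (if i = k then 1 else 0)) * x $ k) = of_real l * x $ i"
  proof -
    have "(\<Sum>k<n. (of_real l * (if i = k then 1 else 0)) * x $ k)
        = (\<Sum>k<n. if i = k then of_real l * x $ k else 0)"
      by (intro sum.cong) auto
    then show ?thesis using assms(3) by simp
  qed
  have A: "A - of_real l \<cdot>\<^sub>m 1\<^sub>m n \<in> carrier_mat n n" "of_real l \<cdot>\<^sub>m 1\<^sub>m n - A \<in> carrier_mat n n"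
    using assms(1) by auto
  show ?l
    unfolding index_mult_mat_vec_sum[OF A(2) assms(2,3)] index_mult_mat_vec_sum[OF assms]
      d[symmetric] sum_subtractf[symmetric]
    using assms by (intro sum.cong) (auto simp: left_diff_distrib)
  show ?r
    unfolding index_mult_mat_vec_sum[OF A(1) assms(2,3)] index_mult_mat_vec_sum[OF assms]
      d[symmetric] sum_subtractf[symmetric]
    using assms by (intro sum.cong) (auto simp: left_diff_distrib)
qed

text \<open>The columns of T are the columns of W in the eigenbasis U. There the equation As W = ls
  W reads es_i T_ij = ls T_ij, so T lives on the rows with es_i = ls.\<close>

lemma eigenbasis_coordinates:
  fixes As W :: "'g::real_complex_quat mat"
  assumes diag: "diagonalizes U As es" and W: "W \<in> carrier_mat (length es) k"
    and eig: "As * W = of_real ls \<cdot>\<^sub>m W" and iso: "adj W * W = 1\<^sub>m k"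
    and T_def: "T = adj U * W"
  shows "T \<in> carrier_mat (length es) k" "adj T * T = 1\<^sub>m k" "U * T = W"
    "\<And>i j. i < length es \<Longrightarrow> j < k \<Longrightarrow> es ! i \<noteq> ls \<Longrightarrow> T $$ (i, j) = 0"
proof -
  define n where "n = length es"
  define D where "D = (diagonal_of (map of_real es) :: 'g mat)"
  have D: "D \<in> carrier_mat n n"
    using diagonal_of_carrier[of "map of_real es"] by (simp add: D_def n_def)
  have U: "U \<in> carrier_mat n n" "adj U \<in> carrier_mat n n" "U * adj U = 1\<^sub>m n"
    and As: "As \<in> carrier_mat n n" and UAU: "adj U * As * U = D" and W: "W \<in> carrier_mat n k"
    using diag W by (auto simp: diagonalizes_def unitary_mat_def n_def D_def)
  have UA: "adj U * As \<in> carrier_mat n n"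
    by (rule mult_carrier_mat[OF U(2) As])
  have T: "T \<in> carrier_mat n k"
    unfolding T_def by (rule mult_carrier_mat[OF U(2) W])
  then show "T \<in> carrier_mat (length es) k" by (simp add: n_def)
  show UT: "U * T = W"
    unfolding T_def assoc_mult_mat[OF U(1,2) W, symmetric] U(3) by (rule left_mult_one_mat[OF W])
  have "adj T * T = (adj W * U) * T"
    by (simp only: T_def adj_mult[OF U(2) W] adj_adj)
  also have "\<dots> = adj W * (U * T)"
    by (rule assoc_mult_mat[OF adj_carrier[OF W] U(1) T])
  finally show "adj T * T = 1\<^sub>m k"
    by (simp only: UT iso)
  fix i j assume "i < length es" and j: "j < k" and ne: "es ! i \<noteq> ls"
  then have i: "i < n" by (simp add: n_def)
  have "D * T = adj U * As * (U * T)"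
    by (simp only: UAU[symmetric] assoc_mult_mat[OF UA U(1) T])
  also have "\<dots> = adj U * (of_real ls \<cdot>\<^sub>m W)"
    by (simp only: UT assoc_mult_mat[OF U(2) As W] eig)
  finally have "(D * T) $$ (i, j) = (adj U * (of_real ls \<cdot>\<^sub>m W)) $$ (i, j)"
    by simp
  also have "\<dots> = (\<Sum>l<n. adj U $$ (i, l) * (of_real ls * W $$ (l, j)))"
    unfolding index_mult_mat_sum[OF U(2) smult_carrier_mat[OF W] i j]
    using W j by (intro sum.cong) auto
  also have "\<dots> = of_real ls * T $$ (i, j)"
    unfolding T_def index_mult_mat_sum[OF U(2) W i j] sum_distrib_left
    by (intro sum.cong refl) (rule of_real_left_commute[symmetric])
  also have "(D * T) $$ (i, j) = of_real (es ! i) * T $$ (i, j)"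
    using diagonal_of_mult_index[of T "map of_real es" k i j] T i j by (simp add: D_def n_def)
  finally have "of_real (es ! i) * T $$ (i, j) = of_real ls * T $$ (i, j)" .
  then have "(es ! i) *\<^sub>R T $$ (i, j) = ls *\<^sub>R T $$ (i, j)"
    by (simp only: scaleR_conv_of_real)
  then show "T $$ (i, j) = 0"
    using ne by (simp only: scaleR_cancel_right) simp
qed

text \<open>With \<open>T = U\<^sup>* W\<close>, the projection \<open>1 - T T\<^sup>*\<close> has trace zero on the block of \<open>\<lambda>\<^sub>s\<close>, because the
  block has as many indices as \<open>T\<close> has orthonormal columns. Hence the columns of \<open>W\<close> span the whole
  eigenspace, without any dimension theory over the quaternions.\<close>

lemma eigenspace_complement:
  fixes As W :: "'g::real_complex_quat mat"
  assumes diag: "diagonalizes U As es" and W: "W \<in> carrier_mat (length es) k"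
    and eig: "As * W = of_real ls \<cdot>\<^sub>m W" and iso: "adj W * W = 1\<^sub>m k"
    and k: "k = count_list es ls"
    and r: "r \<in> carrier_vec (length es)" "adj W *\<^sub>v r = 0\<^sub>v k"
    and i: "i < length es" "es ! i = ls"
  shows "(adj U *\<^sub>v r) $ i = 0"
proof -
  define n where "n = length es"
  define T where "T = adj U * W"
  note T_facts = eigenbasis_coordinates[OF diag W eig iso T_def]
  have T: "T \<in> carrier_mat n k" "adj T \<in> carrier_mat k n"
    and Tzero: "\<And>i j. i < n \<Longrightarrow> j < k \<Longrightarrow> es ! i \<noteq> ls \<Longrightarrow> T $$ (i, j) = 0"
    using T_facts by (auto simp: n_def)
  have U: "U \<in> carrier_mat n n" "adj U \<in> carrier_mat n n" "U * adj U = 1\<^sub>m n"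
    and W: "W \<in> carrier_mat n k" and r': "r \<in> carrier_vec n" and i': "i < n"
    using diag W r i by (auto simp: diagonalizes_def unitary_mat_def n_def)
  define R where "R = T * adj T"
  have R: "R \<in> carrier_mat n n"
    unfolding R_def by (rule mult_carrier_mat[OF T])
  have TtT: "adj T * T = 1\<^sub>m k" using T_facts by simp
  have RR: "R * R = R"
    unfolding R_def assoc_mult_mat[OF T(1,2) R[unfolded R_def]]
      assoc_mult_mat[OF T(2,1,2), symmetric] TtT left_mult_one_mat[OF T(2)] ..
  have adjR: "adj R = R"
    unfolding R_def adj_mult[OF T] adj_adj ..
  then have R_sym: "conjugate (R $$ (i, j)) = R $$ (j, i)" if "i < n" "j < n" for i j
    using that R by (intro hermitian_index[of _ n]) (auto simp: hermitian_def)
  define S where "S = {i. i < n \<and> es ! i = ls}"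
  have S: "finite S" "card S = k" "S \<subseteq> {..<n}"
    using card_count_list[of es ls] by (auto simp: S_def n_def k)
  define \<delta> :: "nat \<Rightarrow> nat \<Rightarrow> 'g" where "\<delta> i j = (if i = j then 1 else 0)" for i j
  \<comment> \<open>The squared length of row i of 1 - R. As 1 - R is Hermitian and idempotent, this
    is also its diagonal entry, which row i of T determines.\<close>
  define f where "f i = (\<Sum>j<n. sqnorm (\<delta> i j - R $$ (i, j)))" for i
  have f: "f i = 1 - (\<Sum>l<k. sqnorm (T $$ (i, l)))" if i: "i < n" for i
  proof -
    have "R $$ (i, i) = of_real (\<Sum>l<k. sqnorm (T $$ (i, l)))"
      unfolding R_def index_mult_mat_sum[OF T i i]
      using T i by (simp add: mult_conj_self)
    moreover have "of_real (f i) = 1 - R $$ (i, i)"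
    proof -
      have "of_real (f i) = (\<Sum>j<n. (\<delta> i j - R $$ (i, j)) * conjugate (\<delta> i j - R $$ (i, j)))"
        by (simp only: f_def of_real_sum mult_conj_self)
      also have "\<dots> = (\<Sum>j<n. (if j = i then 1 - R $$ (i, j) - R $$ (j, i) else 0)
          + R $$ (i, j) * R $$ (j, i))"
        using i by (intro sum.cong) (auto simp: conj_diff R_sym \<delta>_def algebra_simps)
      also have "\<dots> = 1 - R $$ (i, i) - R $$ (i, i) + (R * R) $$ (i, i)"
        unfolding index_mult_mat_sum[OF R R i i] using i by (simp add: sum.distrib)
      finally show ?thesis by (simp add: RR)
    qed
    ultimately have "(of_real (f i) :: 'g) = of_real (1 - (\<Sum>l<k. sqnorm (T $$ (i, l))))"
      by simp
    then show ?thesis by (simp only: of_real_eq_iff)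
  qed
  have col: "(\<Sum>i<n. sqnorm (T $$ (i, l))) = 1" if l: "l < k" for l
  proof -
    have "of_real (\<Sum>i<n. sqnorm (T $$ (i, l))) = (adj T * T) $$ (l, l)"
      unfolding index_mult_mat_sum[OF T(2,1) l l] using T l by (simp add: conj_mult_self)
    also have "\<dots> = of_real 1"
      using l by (simp add: TtT)
    finally show ?thesis
      by (simp only: of_real_eq_iff)
  qed
  \<comment> \<open>Rows of T outside S vanish, so summing over S collects all k unit columns. Since
    S has k elements, the nonnegative numbers f i add up to 0 over S.\<close>
  have "(\<Sum>i\<in>S. \<Sum>l<k. sqnorm (T $$ (i, l))) = (\<Sum>i<n. \<Sum>l<k. sqnorm (T $$ (i, l)))"
    using S by (intro sum.mono_neutral_left) (auto simp: S_def Tzero)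
  also have "\<dots> = (\<Sum>l<k. \<Sum>i<n. sqnorm (T $$ (i, l)))"
    by (rule sum.swap)
  also have "\<dots> = card S"
    by (simp add: col S)
  finally have "(\<Sum>i\<in>S. f i) = 0"
    using S by (simp add: f subset_eq sum_subtractf)
  moreover have "f i \<ge> 0" for i
    by (simp add: f_def sum_nonneg sqnorm_ge_0)
  ultimately have "f i = 0"
    using S(1) i by (auto simp: sum_nonneg_eq_0_iff S_def n_def)
  then have R_row: "R $$ (i, j) = \<delta> i j" if "j < n" for j
    using that by (auto simp: f_def sum_nonneg_eq_0_iff sqnorm_ge_0 sqnorm_eq_0_iff)
  define z where "z = adj U *\<^sub>v r"
  have z: "z \<in> carrier_vec n"
    unfolding z_def by (rule mult_mat_vec_carrier[OF U(2) r'])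
  have "adj T *\<^sub>v z = (adj W * U) *\<^sub>v z"
    by (simp only: T_def adj_mult[OF U(2) W] adj_adj)
  also have "\<dots> = adj W *\<^sub>v (U *\<^sub>v z)"
    by (rule assoc_mult_mat_vec[OF adj_carrier[OF W] U(1) z])
  also have "U *\<^sub>v z = r"
    unfolding z_def assoc_mult_mat_vec[OF U(1,2) r', symmetric] U(3)
    by (rule one_mult_mat_vec[OF r'])
  \<comment> \<open>R z = T (adj W r) vanishes by orthogonality, whereas row i of R is the unit row
    and returns z_i.\<close>
  finally have "R *\<^sub>v z = T *\<^sub>v 0\<^sub>v k"
    unfolding R_def assoc_mult_mat_vec[OF T z] by (simp only: r(2))
  then have "(R *\<^sub>v z) $ i = 0"
    using T i' by (simp add: index_mult_mat_vec_sum[of _ n k] del: index_mult_mat_vec)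
  moreover have "(R *\<^sub>v z) $ i = (\<Sum>j<n. if j = i then z $ j else 0)"
    unfolding index_mult_mat_vec_sum[OF R z i'] by (intro sum.cong) (auto simp: R_row \<delta>_def)
  ultimately show ?thesis
    using i' by (simp add: z_def)
qed

text \<open>In the eigenbasis the operator ls - As is diagonal with entries ls - es_i. The
  coordinates of r vanish wherever these do, so an entrywise division solves the equation.\<close>

lemma eigenvector_equation_solvable:
  fixes As W :: "'g::real_complex_quat mat"
  assumes diag: "diagonalizes U As es" and W: "W \<in> carrier_mat (length es) k"
    and eig: "As * W = of_real ls \<cdot>\<^sub>m W" and iso: "adj W * W = 1\<^sub>m k"
    and k: "k = count_list es ls"
    and r: "r \<in> carrier_vec (length es)" "adj W *\<^sub>v r = 0\<^sub>v k"
  shows "\<exists>x \<in> carrier_vec (length es). (of_real ls \<cdot>\<^sub>m 1\<^sub>m (length es) - As) *\<^sub>v x = r"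
proof -
  define n where "n = length es"
  define D where "D = (diagonal_of (map of_real es) :: 'g mat)"
  have D: "D \<in> carrier_mat n n"
    using diagonal_of_carrier[of "map of_real es"] by (simp add: D_def n_def)
  have U: "U \<in> carrier_mat n n" "adj U \<in> carrier_mat n n" "U * adj U = 1\<^sub>m n"
    and As: "As \<in> carrier_mat n n" and UAU: "adj U * As * U = D" and r': "r \<in> carrier_vec n"
    using diag r by (auto simp: diagonalizes_def unitary_mat_def n_def D_def)
  define z where "z = adj U *\<^sub>v r"
  have z: "z \<in> carrier_vec n"
    unfolding z_def by (rule mult_mat_vec_carrier[OF U(2) r'])
  have z0: "z $ i = 0" if "i < n" "es ! i = ls" for i
    using eigenspace_complement[OF assms, of i] that by (simp add: z_def n_def)
  \<comment> \<open>At es_i = ls the convention 1 / 0 = 0 yields y_i = 0, which fits because z_i = 0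
    there.\<close>
  define y where "y = vec n (\<lambda>i. (1 / (ls - es ! i)) *\<^sub>R z $ i)"
  have y: "y \<in> carrier_vec n" by (simp add: y_def)
  have ly: "of_real ls * y $ i = of_real (es ! i) * y $ i + z $ i" if "i < n" for i
  proof (cases "es ! i = ls")
    case True
    then show ?thesis using z0 that by (simp add: y_def)
  next
    case False
    then have "(ls - es ! i) *\<^sub>R y $ i = z $ i"
      using that by (simp add: y_def)
    then show ?thesis
      by (simp add: scaleR_conv_of_real algebra_simps)
  qed
  have Dy: "(D *\<^sub>v y) $ i = of_real (es ! i) * y $ i" if "i < n" for i
  proof -
    have "(D *\<^sub>v y) $ i = (\<Sum>j<n. if j = i then of_real (es ! i) * y $ j else 0)"
      unfolding index_mult_mat_vec_sum[OF D y that]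
      using that by (intro sum.cong) (auto simp: D_def n_def diagonal_of_index)
    then show ?thesis using that by simp
  qed
  have "As * U = U * D"
  proof -
    have "U * D = U * adj U * (As * U)"
      unfolding UAU[symmetric] assoc_mult_mat[OF U(2) As U(1)]
      by (rule assoc_mult_mat[symmetric, OF U(1,2) mult_carrier_mat[OF As U(1)]])
    then show ?thesis
      by (simp only: U(3) left_mult_one_mat[OF mult_carrier_mat[OF As U(1)]])
  qed
  then have AUy: "As *\<^sub>v (U *\<^sub>v y) = U *\<^sub>v (D *\<^sub>v y)"
    by (simp only: assoc_mult_mat_vec[OF As U(1) y, symmetric] assoc_mult_mat_vec[OF U(1) D y, symmetric])
  have Uy: "U *\<^sub>v y \<in> carrier_vec n" and Dyc: "D *\<^sub>v y \<in> carrier_vec n"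
    using U D y by auto
  have "(of_real ls \<cdot>\<^sub>m 1\<^sub>m n - As) *\<^sub>v (U *\<^sub>v y) = r"
  proof (rule eq_vecI)
    fix i assume "i < dim_vec r"
    then have i: "i < n" using r' by auto
    have "((of_real ls \<cdot>\<^sub>m 1\<^sub>m n - As) *\<^sub>v (U *\<^sub>v y)) $ i
        = of_real ls * (U *\<^sub>v y) $ i - (U *\<^sub>v (D *\<^sub>v y)) $ i"
      by (simp only: shifted_mult_vec_index[OF As Uy i] AUy)
    also have "\<dots> = (\<Sum>j<n. U $$ (i, j) * (of_real ls * y $ j - (D *\<^sub>v y) $ j))"
      unfolding index_mult_mat_vec_sum[OF U(1) y i] index_mult_mat_vec_sum[OF U(1) Dyc i]
        sum_distrib_left sum_subtractf[symmetric]
      by (intro sum.cong refl) (simp only: right_diff_distrib of_real_left_commute)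
    also have "\<dots> = (\<Sum>j<n. U $$ (i, j) * z $ j)"
      by (intro sum.cong refl) (simp add: Dy ly del: index_mult_mat_vec)
    also have "\<dots> = (U *\<^sub>v z) $ i"
      by (rule index_mult_mat_vec_sum[OF U(1) z i, symmetric])
    also have "U *\<^sub>v z = r"
      unfolding z_def assoc_mult_mat_vec[OF U(1,2) r', symmetric] U(3)
      by (rule one_mult_mat_vec[OF r'])
    finally show "((of_real ls \<cdot>\<^sub>m 1\<^sub>m n - As) *\<^sub>v (U *\<^sub>v y)) $ i = r $ i" .
  qed (use As r' in auto)
  then show ?thesis
    using Uy by (auto simp: n_def)
qed

section \<open>Dual eigenvectors and the matrix of orthonormal eigenvectors\<close>

lemma dual_eigenvectorI:
  fixes As Ad :: "'g::real_complex_quat mat"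
  assumes As: "As \<in> carrier_mat n n" and Ad: "Ad \<in> carrier_mat n n"
    and x: "right_eigenvector As x (of_real ls)" and xd: "xd \<in> carrier_vec n"
    and eq: "(of_real ls \<cdot>\<^sub>m 1\<^sub>m n - As) *\<^sub>v xd = (Ad - of_real ld \<cdot>\<^sub>m 1\<^sub>m n) *\<^sub>v x"
  shows "dual_eigenvector (dual_mat As Ad) (dual_vec x xd) (map_dual of_real (Dual ls ld))"
proof -
  have xc: "x \<in> carrier_vec n" "x \<noteq> 0\<^sub>v n" "As *\<^sub>v x = smult_vec_right x (of_real ls)"
    using x As by (auto simp: right_eigenvector_def)
  have "dual_mat As Ad *\<^sub>v dual_vec x xd = smult_vec_right (dual_vec x xd) (Dual (of_real ls) (of_real ld))"
    unfolding dual_mat_mult_vec[OF As Ad xc(1) xd]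
  proof (rule eq_vecI)
    fix i assume "i < dim_vec (smult_vec_right (dual_vec x xd) (Dual (of_real ls) (of_real ld)))"
    then have i: "i < n" using xc by (simp add: smult_vec_right_def dual_vec_def)
    have "of_real ls * xd $ i - (As *\<^sub>v xd) $ i = (Ad *\<^sub>v x) $ i - of_real ld * x $ i"
      using arg_cong[OF eq, of "\<lambda>v. v $ i"]
      by (simp only: shifted_mult_vec_index[OF As xd i] shifted_mult_vec_index[OF Ad xc(1) i])
    then have "(As *\<^sub>v xd) $ i + (Ad *\<^sub>v x) $ i = x $ i * of_real ld + xd $ i * of_real ls"
      by (simp add: of_real_commute algebra_simps del: index_mult_mat_vec)
    then show "dual_vec (As *\<^sub>v x) (As *\<^sub>v xd + Ad *\<^sub>v x) $ i
        = smult_vec_right (dual_vec x xd) (Dual (of_real ls) (of_real ld)) $ i"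
      using i xc(1) As Ad xd
      by (simp add: xc(3) dual_vec_def smult_vec_right_def times_dual_def del: index_mult_mat_vec)
  qed (use As xc in \<open>simp add: smult_vec_right_def dual_vec_def\<close>)
  moreover have "map_vec std_part (dual_vec x xd) = x"
    by (intro eq_vecI) (auto simp: dual_vec_def)
  ultimately show ?thesis
    using xc As by (simp add: dual_eigenvector_def appreciable_def dual_vec_def dual_mat_def)
qed

lemma hermitian_dual_part:
  assumes "hermitian A" "A \<in> carrier_mat n n"
  shows "hermitian (map_mat dual_part A)"
  unfolding hermitian_def
proof (rule eq_matI)
  fix i j assume "i < dim_row (map_mat dual_part A)" "j < dim_col (map_mat dual_part A)"
  then show "adj (map_mat dual_part A) $$ (i, j) = map_mat dual_part A $$ (i, j)"
    using assms(2) arg_cong[OF hermitian_index[OF assms, of j i], of dual_part]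
    by (simp add: conjugate_dual_def)
qed (use assms in auto)

text \<open>Applied with X = adj W, it reduces orthogonality of the right-hand side to comparing adj
  W A_d x_s with the real multiple of adj W x_s. The real factor may be moved past the entries of
  X.\<close>

lemma mult_shifted_vec_index:
  fixes A X :: "'g::real_complex_quat mat"
  assumes A: "A \<in> carrier_mat n n" and x: "x \<in> carrier_vec n" and X: "X \<in> carrier_mat k n" and j: "j < k"
  shows "(X *\<^sub>v ((A - of_real l \<cdot>\<^sub>m 1\<^sub>m n) *\<^sub>v x)) $ j
    = (X *\<^sub>v (A *\<^sub>v x)) $ j - of_real l * (X *\<^sub>v x) $ j"
proof -
  have Ax: "A *\<^sub>v x \<in> carrier_vec n" using A x by simp
  have Nx: "(A - of_real l \<cdot>\<^sub>m 1\<^sub>m n) *\<^sub>v x \<in> carrier_vec n"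
    by (rule mult_mat_vec_carrier[OF _ x]) (use A in auto)
  show ?thesis
    unfolding index_mult_mat_vec_sum[OF X Nx j] index_mult_mat_vec_sum[OF X Ax j]
      index_mult_mat_vec_sum[OF X x j] sum_distrib_left sum_subtractf[symmetric]
    by (intro sum.cong refl)
      (simp add: shifted_mult_vec_index[OF A x] right_diff_distrib of_real_left_commute
        del: index_mult_mat_vec)
qed

lemma orthonormal_eigenvectors_mat:
  fixes As :: "'g::real_complex_quat mat"
  assumes As: "As \<in> carrier_mat n n" and vs: "\<forall>v \<in> set vs. right_eigenvector As v (of_real ls)"
    and on: "orthonormal vs"
  shows "adj (mat_of_cols n vs) * mat_of_cols n vs = 1\<^sub>m (length vs)"
    "As * mat_of_cols n vs = of_real ls \<cdot>\<^sub>m mat_of_cols n vs"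
proof -
  define W where "W = mat_of_cols n vs"
  have W: "W \<in> carrier_mat n (length vs)" by (simp add: W_def)
  have v: "vs ! j \<in> carrier_vec n" "As *\<^sub>v (vs ! j) = smult_vec_right (vs ! j) (of_real ls)"
    if "j < length vs" for j
    using vs As that by (auto simp: right_eigenvector_def)
  have W_index: "W $$ (i, j) = vs ! j $ i" if "i < n" "j < length vs" for i j
    using that by (simp add: W_def mat_of_cols_index)
  show "adj (mat_of_cols n vs) * mat_of_cols n vs = 1\<^sub>m (length vs)"
    unfolding W_def[symmetric]
  proof (rule eq_matI)
    fix i j assume "i < dim_row (1\<^sub>m (length vs))" "j < dim_col (1\<^sub>m (length vs))"
    then have ij: "i < length vs" "j < length vs" by auto
    have "(adj W * W) $$ (i, j) = cinner (vs ! i) (vs ! j)"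
      unfolding index_mult_mat_sum[OF adj_carrier[OF W] W ij] cinner_sum[OF v(1)[OF ij(1)] v(1)[OF ij(2)]]
      using W ij by (intro sum.cong) (auto simp: W_index)
    then show "(adj W * W) $$ (i, j) = 1\<^sub>m (length vs) $$ (i, j)"
      using on ij by (simp add: orthonormal_def)
  qed (use W in auto)
  show "As * mat_of_cols n vs = of_real ls \<cdot>\<^sub>m mat_of_cols n vs"
    unfolding W_def[symmetric]
  proof (rule eq_matI)
    fix i j assume "i < dim_row (of_real ls \<cdot>\<^sub>m W)" "j < dim_col (of_real ls \<cdot>\<^sub>m W)"
    then have ij: "i < n" "j < length vs" using W by auto
    have "(As * W) $$ (i, j) = (As *\<^sub>v (vs ! j)) $ i"
      unfolding index_mult_mat_sum[OF As W ij] index_mult_mat_vec_sum[OF As v(1)[OF ij(2)] ij(1)]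
      using ij by (intro sum.cong) (auto simp: W_index)
    then show "(As * W) $$ (i, j) = (of_real ls \<cdot>\<^sub>m W) $$ (i, j)"
      using W ij v[OF ij(2)] by (simp add: W_index smult_vec_right_def of_real_commute del: index_mult_mat)
  qed (use W As in auto)
qed

lemma less_one_nat: "0 < (1::nat)"
  by simp

text \<open>Treats a single eigenvector as a matrix with one column, so that case (1) can use the
  results stated for W; scalars then appear as entry 0 of vectors or (0, 0) of matrices.\<close>

lemma quadratic_form_mat_of_cols:
  fixes A :: "'g::real_complex_quat mat"
  assumes A: "A \<in> carrier_mat n n" and x: "x \<in> carrier_vec n"
  shows "(adj (mat_of_cols n [x]) *\<^sub>v x) $ 0 = cinner x x"
    "(adj (mat_of_cols n [x]) *\<^sub>v (A *\<^sub>v x)) $ 0 = cinner x (A *\<^sub>v x)"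
    "(adj (mat_of_cols n [x]) * A * mat_of_cols n [x]) $$ (0, 0) = cinner x (A *\<^sub>v x)"
proof -
  define W where "W = mat_of_cols n [x]"
  have W: "W \<in> carrier_mat n 1" "adj W \<in> carrier_mat 1 n"
    using mat_of_cols_carrier(1)[of n "[x]"] by (auto simp: W_def)
  have W_index: "W $$ (i, 0) = x $ i" if "i < n" for i
    using that by (simp add: W_def mat_of_cols_index)
  have adj_W: "(adj W *\<^sub>v y) $ 0 = cinner x y" if "y \<in> carrier_vec n" for y
    unfolding index_mult_mat_vec_sum[OF W(2) that less_one_nat] cinner_sum[OF x that]
    using W by (intro sum.cong) (auto simp: W_index)
  have Ax: "A *\<^sub>v x \<in> carrier_vec n" using A x by simp
  show "(adj (mat_of_cols n [x]) *\<^sub>v x) $ 0 = cinner x x"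
    and *: "(adj (mat_of_cols n [x]) *\<^sub>v (A *\<^sub>v x)) $ 0 = cinner x (A *\<^sub>v x)"
    using adj_W[OF x] adj_W[OF Ax] by (simp_all only: W_def)
  have AW: "A * W \<in> carrier_mat n 1" by (rule mult_carrier_mat[OF A W(1)])
  have AWx: "(A * W) $$ (i, 0) = (A *\<^sub>v x) $ i" if "i < n" for i
    unfolding index_mult_mat_sum[OF A W(1) that less_one_nat] index_mult_mat_vec_sum[OF A x that]
    by (intro sum.cong) (auto simp: W_index)
  have "(adj W * A * W) $$ (0, 0) = (adj W *\<^sub>v (A *\<^sub>v x)) $ 0"
    unfolding assoc_mult_mat[OF W(2) A W(1)] index_mult_mat_sum[OF W(2) AW less_one_nat less_one_nat]
      index_mult_mat_vec_sum[OF W(2) Ax less_one_nat]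
    by (intro sum.cong refl) (simp add: AWx del: index_mult_mat_vec index_mult_mat(1))
  then show "(adj (mat_of_cols n [x]) * A * mat_of_cols n [x]) $$ (0, 0) = cinner x (A *\<^sub>v x)"
    using * by (simp only: W_def)
qed

text \<open>W y cannot vanish because adj W recovers y from it, and As W = ls W carries the
  eigenvalue over.\<close>

lemma mult_right_eigenvector:
  fixes As W :: "'g::real_complex_quat mat"
  assumes As: "As \<in> carrier_mat n n" and W: "W \<in> carrier_mat n k" and iso: "adj W * W = 1\<^sub>m k"
    and eig: "As * W = of_real ls \<cdot>\<^sub>m W" and y: "y \<in> carrier_vec k" "y \<noteq> 0\<^sub>v k"
  shows "right_eigenvector As (W *\<^sub>v y) (of_real ls)"
proof -
  have Wy: "W *\<^sub>v y \<in> carrier_vec n" using W y by simp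
  have "adj W *\<^sub>v (W *\<^sub>v y) = y"
    using y by (simp only: assoc_mult_mat_vec[OF adj_carrier[OF W] W y(1), symmetric] iso
        one_mult_mat_vec)
  moreover have "adj W *\<^sub>v 0\<^sub>v n = 0\<^sub>v k"
    using W by (intro eq_vecI) auto
  ultimately have "W *\<^sub>v y \<noteq> 0\<^sub>v n"
    using y by metis
  moreover have "As *\<^sub>v (W *\<^sub>v y) = smult_vec_right (W *\<^sub>v y) (of_real ls)"
  proof (rule eq_vecI)
    fix i assume "i < dim_vec (smult_vec_right (W *\<^sub>v y) (of_real ls))"
    then have i: "i < n" using W by (simp add: smult_vec_right_def)
    have "(As *\<^sub>v (W *\<^sub>v y)) $ i = ((of_real ls \<cdot>\<^sub>m W) *\<^sub>v y) $ i"
      by (simp only: assoc_mult_mat_vec[OF As W y(1), symmetric] eig)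
    also have "\<dots> = of_real ls * (W *\<^sub>v y) $ i"
      unfolding index_mult_mat_vec_sum[OF smult_carrier_mat[OF W] y(1) i]
        index_mult_mat_vec_sum[OF W y(1) i] sum_distrib_left
      using W i by (intro sum.cong) (auto simp: mult.assoc)
    finally show "(As *\<^sub>v (W *\<^sub>v y)) $ i = smult_vec_right (W *\<^sub>v y) (of_real ls) $ i"
      using W i by (simp add: smult_vec_right_def of_real_commute del: index_mult_mat_vec)
  qed (use W As in \<open>simp add: smult_vec_right_def\<close>)
  ultimately show ?thesis
    using Wy As by (simp add: right_eigenvector_def)
qed

theorem theorem4p1:
  fixes A :: "'g::real_complex_quat dual mat" and As Ad :: "'g mat"
    and ls :: real and n k :: nat
  assumes "A \<in> carrier_mat n n" and "hermitian A"
    and "As = map_mat std_part A" and "Ad = map_mat dual_part A"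
    and "multiple_eigenvalue k As ls"
  shows
    "(k = 1 \<longrightarrow>
       (\<forall>xs. right_eigenvector As xs (of_real ls) \<and> cinner xs xs = 1 \<longrightarrow>
         (\<exists>ld :: real.
            of_real ld = cinner xs (Ad *\<^sub>v xs) \<and>
            dual_multiple_eigenvalue 1 A (Dual ls ld) \<and>
            (\<exists>xd \<in> carrier_vec n.
               (of_real ls \<cdot>\<^sub>m 1\<^sub>m n - As) *\<^sub>v xd = (Ad - of_real ld \<cdot>\<^sub>m 1\<^sub>m n) *\<^sub>v xs) \<and>
            (\<forall>xd \<in> carrier_vec n.
               (of_real ls \<cdot>\<^sub>m 1\<^sub>m n - As) *\<^sub>v xd = (Ad - of_real ld \<cdot>\<^sub>m 1\<^sub>m n) *\<^sub>v xs \<longrightarrow>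
               dual_eigenvector A (dual_vec xs xd) (map_dual of_real (Dual ls ld))))))
     \<and>
     (k > 1 \<longrightarrow>
       (\<forall>vs W.
         length vs = k \<and> (\<forall>v \<in> set vs. right_eigenvector As v (of_real ls)) \<and>
         orthonormal vs \<and> W = mat_of_cols n vs \<longrightarrow>
           W \<in> carrier_mat n k \<and> partially_unitary W \<and>
           adj W * Ad * W \<in> carrier_mat k k \<and> hermitian (adj W * Ad * W) \<and>
           (\<forall>lds ys.
             eigenvalue_list (adj W * Ad * W) lds \<and> length ys = k \<and>
             (\<forall>i<k. right_eigenvector (adj W * Ad * W) (ys ! i) (of_real (lds ! i))) \<longrightarrow>
             (\<forall>i<k.
               dual_eigenvalue A (map_dual of_real (Dual ls (lds ! i))) \<and>
               (\<exists>xd \<in> carrier_vec n.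
                  (of_real ls \<cdot>\<^sub>m 1\<^sub>m n - As) *\<^sub>v xd
                    = (Ad - of_real (lds ! i) \<cdot>\<^sub>m 1\<^sub>m n) *\<^sub>v (W *\<^sub>v (ys ! i))) \<and>
               (\<forall>xd \<in> carrier_vec n.
                  (of_real ls \<cdot>\<^sub>m 1\<^sub>m n - As) *\<^sub>v xd
                    = (Ad - of_real (lds ! i) \<cdot>\<^sub>m 1\<^sub>m n) *\<^sub>v (W *\<^sub>v (ys ! i)) \<longrightarrow>
                  dual_eigenvector A (dual_vec (W *\<^sub>v (ys ! i)) xd)
                    (map_dual of_real (Dual ls (lds ! i))))))))"
proof -
  have As: "As \<in> carrier_mat n n" and Ad: "Ad \<in> carrier_mat n n" "hermitian Ad"
    using assms(1-4) hermitian_dual_part[of A n] by auto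
  have A: "A = dual_mat As Ad"
    using assms(1,3,4) by (intro eq_matI) (auto simp: dual_mat_def)
  obtain es where es: "eigenvalue_list As es" "count_list es ls = k"
    using assms(5) by (auto simp: multiple_eigenvalue_def)
  have n: "length es = n"
    using es(1) As by (auto simp: eigenvalue_list_iff diagonalizes_def)
  have "\<exists>U \<mu>. diagonalizes U As es \<and> (\<forall>i<n. (adj U * Ad * U) $$ (i, i) = of_real (\<mu> i)) \<and>
      dual_eigenvalue_list A (map (\<lambda>i. Dual (es ! i) (\<mu> i)) [0..<n])"
    using dual_diagonalization[OF es(1), of Ad] Ad unfolding n A .
  then obtain U \<mu> where U: "diagonalizes U As es"
    and \<mu>: "\<And>i. i < n \<Longrightarrow> (adj U * Ad * U) $$ (i, i) = of_real (\<mu> i)"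
    and L: "dual_eigenvalue_list A (map (\<lambda>i. Dual (es ! i) (\<mu> i)) [0..<n])"
    by auto
  have Uc: "U \<in> carrier_mat n n"
    using U by (simp add: diagonalizes_def unitary_mat_def n)
  have solve: "\<exists>x \<in> carrier_vec n. (of_real ls \<cdot>\<^sub>m 1\<^sub>m n - As) *\<^sub>v x = r"
    if "W \<in> carrier_mat n k" "As * W = of_real ls \<cdot>\<^sub>m W" "adj W * W = 1\<^sub>m k"
      "r \<in> carrier_vec n" "adj W *\<^sub>v r = 0\<^sub>v k" for W r
    by (rule eigenvector_equation_solvable[OF U, unfolded n, OF that(1-3) es(2)[symmetric] that(4,5)])
  show ?thesis
  proof (intro conjI impI allI)
    fix xs assume k: "k = 1" and xs': "right_eigenvector As xs (of_real ls) \<and> cinner xs xs = 1"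
    then have xs: "right_eigenvector As xs (of_real ls)" "cinner xs xs = 1" "xs \<in> carrier_vec n"
      using As by (auto simp: right_eigenvector_def)
    define W where "W = mat_of_cols n [xs]"
    have W: "W \<in> carrier_mat n 1"
      using mat_of_cols_carrier(1)[of n "[xs]"] by (simp add: W_def)
    have Wm: "adj W * W = 1\<^sub>m 1" "As * W = of_real ls \<cdot>\<^sub>m W"
      using orthonormal_eigenvectors_mat[OF As, of "[xs]" ls] xs by (auto simp: W_def orthonormal_def)
    define T where "T = adj U * W"
    have T: "T \<in> carrier_mat n 1" "adj T * T = 1\<^sub>m 1" "U * T = W"
      and T0: "\<And>i. i < n \<Longrightarrow> es ! i \<noteq> ls \<Longrightarrow> T $$ (i, 0) = 0"
      using eigenbasis_coordinates[OF U _ Wm(2,1) T_def] W by (auto simp: n)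
    have "card {i. i < n \<and> es ! i = ls} = 1"
      using card_count_list[of es ls] es(2) k n by simp
    then obtain m where m: "{i. i < n \<and> es ! i = ls} = {m}"
      by (auto simp: card_1_singleton_iff)
    then have m': "m < n" "es ! m = ls" by auto
    \<comment> \<open>Simplicity leaves one position m of ls in the list, so the eigenvector is
      column m of U times a single scalar, of modulus 1 by the next step.\<close>
    have T0: "T $$ (i, 0) = 0" if "i < n" "i \<noteq> m" for i
      using T0[OF that(1)] m that by blast
    have Tm: "conjugate (T $$ (m, 0)) * T $$ (m, 0) = 1"
    proof -
      have "(adj T * T) $$ (0, 0)
          = (\<Sum>l<n. if l = m then conjugate (T $$ (l, 0)) * T $$ (l, 0) else 0)"
        unfolding index_mult_mat_sum[OF adj_carrier[OF T(1)] T(1) less_one_nat less_one_nat]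
        using T(1) by (intro sum.cong) (auto simp: T0)
      then show ?thesis using m' by (simp add: T(2))
    qed
    \<comment> \<open>With xs = U T the form collapses to conjugate t * \<mu> m * t for t = T_m0.
      The middle factor is real, so t cancels: lambda_d is real and is the number that the dual
      diagonalization pairs with es_m.\<close>
    have "cinner xs (Ad *\<^sub>v xs) = (adj T * (adj U * Ad * U) * T) $$ (0, 0)"
      using quadratic_form_mat_of_cols(3)[OF Ad(1) xs(3)]
      by (simp only: congruence_mult[OF Ad(1) Uc T(1), symmetric] T(3) W_def)
    also have "\<dots> = (\<Sum>l<n. \<Sum>l'<n. if l' = m then if l = m then
        conjugate (T $$ (l', 0)) * (adj U * Ad * U) $$ (l', l) * T $$ (l, 0) else 0 else 0)"
      unfolding index_congruence[OF mult_carrier_mat[OF mult_carrier_mat[OF adj_carrier[OF Uc] Ad(1)] Uc]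
          T(1) less_one_nat less_one_nat]
      by (intro sum.cong refl) (auto simp: T0)
    also have "\<dots> = conjugate (T $$ (m, 0)) * of_real (\<mu> m) * T $$ (m, 0)"
      using m' by (simp add: \<mu> del: index_mult_mat(1))
    also have "\<dots> = of_real (\<mu> m) * (conjugate (T $$ (m, 0)) * T $$ (m, 0))"
      by (simp only: of_real_commute[symmetric, of "conjugate _"] mult.assoc)
    finally have ld: "cinner xs (Ad *\<^sub>v xs) = of_real (\<mu> m)"
      by (simp add: Tm)
    let ?r = "(Ad - of_real (\<mu> m) \<cdot>\<^sub>m 1\<^sub>m n) *\<^sub>v xs"
    have r: "?r \<in> carrier_vec n"
      by (rule mult_mat_vec_carrier[OF _ xs(3)]) (use Ad in auto)
    have "(adj W *\<^sub>v ?r) $ 0 = 0"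
      using mult_shifted_vec_index[OF Ad(1) xs(3) adj_carrier[OF W] less_one_nat]
        quadratic_form_mat_of_cols(1,2)[OF Ad(1) xs(3)] by (simp add: W_def xs(2) ld del: index_mult_mat_vec)
    then have "adj W *\<^sub>v ?r = 0\<^sub>v 1"
      using W by (intro eq_vecI) (auto simp del: index_mult_mat_vec)
    then obtain xd where xd: "xd \<in> carrier_vec n" "(of_real ls \<cdot>\<^sub>m 1\<^sub>m n - As) *\<^sub>v xd = ?r"
      using solve[of W ?r] W Wm r k by blast
    have dual: "dual_eigenvector A (dual_vec xs x) (map_dual of_real (Dual ls (\<mu> m)))"
      if "x \<in> carrier_vec n" "(of_real ls \<cdot>\<^sub>m 1\<^sub>m n - As) *\<^sub>v x = ?r" for x
      unfolding A by (rule dual_eigenvectorI[OF As Ad(1) xs(1) that])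
    \<comment> \<open>Other dual eigenvalues already differ in the standard part, whatever their
      dual parts are.\<close>
    have "{i. i < n \<and> Dual (es ! i) (\<mu> i) = Dual ls (\<mu> m)} = {m}"
      using m by auto
    then have "count_list (map (\<lambda>i. Dual (es ! i) (\<mu> i)) [0..<n]) (Dual ls (\<mu> m)) = 1"
      by (subst card_count_list[symmetric]) (simp cong: conj_cong)
    then have "dual_multiple_eigenvalue 1 A (Dual ls (\<mu> m))"
      using L dual[OF xd] unfolding dual_multiple_eigenvalue_def dual_eigenvalue_def by blast
    then show "\<exists>ld. of_real ld = cinner xs (Ad *\<^sub>v xs) \<and>
        dual_multiple_eigenvalue 1 A (Dual ls ld) \<and>
        (\<exists>xd \<in> carrier_vec n.
           (of_real ls \<cdot>\<^sub>m 1\<^sub>m n - As) *\<^sub>v xd = (Ad - of_real ld \<cdot>\<^sub>m 1\<^sub>m n) *\<^sub>v xs) \<and>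
        (\<forall>xd \<in> carrier_vec n.
           (of_real ls \<cdot>\<^sub>m 1\<^sub>m n - As) *\<^sub>v xd = (Ad - of_real ld \<cdot>\<^sub>m 1\<^sub>m n) *\<^sub>v xs \<longrightarrow>
           dual_eigenvector A (dual_vec xs xd) (map_dual of_real (Dual ls ld)))"
      using ld xd dual by metis
  next
    fix vs W
    assume "length vs = k \<and> (\<forall>v \<in> set vs. right_eigenvector As v (of_real ls)) \<and>
      orthonormal vs \<and> W = mat_of_cols n vs"
    then have vs: "length vs = k" "W = mat_of_cols n vs"
      and Wm: "adj W * W = 1\<^sub>m k" "As * W = of_real ls \<cdot>\<^sub>m W"
      using orthonormal_eigenvectors_mat[OF As, of vs ls] by auto
    show W: "W \<in> carrier_mat n k"
      using vs by auto
    then show "partially_unitary W"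
      using Wm by (auto simp: partially_unitary_def)
    show M: "adj W * Ad * W \<in> carrier_mat k k"
      by (rule mult_carrier_mat[OF mult_carrier_mat[OF adj_carrier[OF W] Ad(1)] W])
    show "hermitian (adj W * Ad * W)"
      by (rule hermitian_congruence[OF Ad(2,1) W])
    fix lds ys i
    assume "eigenvalue_list (adj W * Ad * W) lds \<and> length ys = k \<and>
      (\<forall>i<k. right_eigenvector (adj W * Ad * W) (ys ! i) (of_real (lds ! i)))" and "i < k"
    then have "right_eigenvector (adj W * Ad * W) (ys ! i) (of_real (lds ! i))"
      by blast
    moreover define y l where "y = ys ! i" and "l = lds ! i"
    ultimately have y: "y \<in> carrier_vec k" "y \<noteq> 0\<^sub>v k"
      and My: "(adj W * Ad * W) *\<^sub>v y = smult_vec_right y (of_real l)"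
      using M by (auto simp: right_eigenvector_def)
    have Wy: "W *\<^sub>v y \<in> carrier_vec n" using W y by simp
    let ?r = "(Ad - of_real l \<cdot>\<^sub>m 1\<^sub>m n) *\<^sub>v (W *\<^sub>v y)"
    have r: "?r \<in> carrier_vec n"
      by (rule mult_mat_vec_carrier[OF _ Wy]) (use Ad in auto)
    have WAd: "adj W * Ad \<in> carrier_mat k n"
      by (rule mult_carrier_mat[OF adj_carrier[OF W] Ad(1)])
    \<comment> \<open>The supplement matrix enters here: adj W maps A_d x_s to y l and maps x_s to
      y. The right-hand side is thus orthogonal to all columns of W precisely because y is an
      eigenvector.\<close>
    have "adj W *\<^sub>v (Ad *\<^sub>v (W *\<^sub>v y)) = smult_vec_right y (of_real l)"
      by (simp only: assoc_mult_mat_vec[OF adj_carrier[OF W] Ad(1) Wy, symmetric]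
          assoc_mult_mat_vec[OF WAd W y(1), symmetric] My)
    moreover have "adj W *\<^sub>v (W *\<^sub>v y) = y"
      using y by (simp only: assoc_mult_mat_vec[OF adj_carrier[OF W] W y(1), symmetric] Wm
          one_mult_mat_vec)
    ultimately have "(adj W *\<^sub>v ?r) $ j = 0" if "j < k" for j
      using mult_shifted_vec_index[OF Ad(1) Wy adj_carrier[OF W] that, of l] y that
      by (simp add: smult_vec_right_def of_real_commute del: index_mult_mat_vec)
    then have "adj W *\<^sub>v ?r = 0\<^sub>v k"
      using W by (intro eq_vecI) (auto simp del: index_mult_mat_vec)
    then obtain xd where xd: "xd \<in> carrier_vec n" "(of_real ls \<cdot>\<^sub>m 1\<^sub>m n - As) *\<^sub>v xd = ?r"
      using solve[of W ?r] W Wm r by blast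
    have dual: "dual_eigenvector A (dual_vec (W *\<^sub>v y) x) (map_dual of_real (Dual ls l))"
      if "x \<in> carrier_vec n" "(of_real ls \<cdot>\<^sub>m 1\<^sub>m n - As) *\<^sub>v x = ?r" for x
      unfolding A
      by (rule dual_eigenvectorI[OF As Ad(1) mult_right_eigenvector[OF As W Wm y] that])
    show "dual_eigenvalue A (map_dual of_real (Dual ls (lds ! i)))"
      using dual[OF xd] unfolding dual_eigenvalue_def l_def by blast
    show "\<exists>xd \<in> carrier_vec n. (of_real ls \<cdot>\<^sub>m 1\<^sub>m n - As) *\<^sub>v xd
        = (Ad - of_real (lds ! i) \<cdot>\<^sub>m 1\<^sub>m n) *\<^sub>v (W *\<^sub>v (ys ! i))"
      using xd unfolding l_def y_def by blast
    show "\<forall>xd \<in> carrier_vec n. (of_real ls \<cdot>\<^sub>m 1\<^sub>m n - As) *\<^sub>v xd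
        = (Ad - of_real (lds ! i) \<cdot>\<^sub>m 1\<^sub>m n) *\<^sub>v (W *\<^sub>v (ys ! i)) \<longrightarrow>
        dual_eigenvector A (dual_vec (W *\<^sub>v (ys ! i)) xd) (map_dual of_real (Dual ls (lds ! i)))"
      using dual unfolding l_def y_def by blast
  qed
qed

end
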